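(* Under the hypotheses and notation below, let $j\ge0$. There exists a Laurent polynomial $g_j(x;t)$ in $x$ with coefficients in the field $\mathbb{Q}_A$ such that $$(2tA_1(x))^j\,S_j^+(x;t)=\frac{f_j^+(x;t)}{\sqrt{\Delta(x)}}-g_j(x;t),\qquad (2tA_1(x))^j\,S_j^-(x;t)=g_j(x;t)-f_j^-(x;t)\sqrt{D\,\bar\Delta(\bar x)},$$ where $S_j^+(x;t)=\sum_{n\ge0}\sum_{i\ge0}a_{i,j}(n)x^it^n$ and $S_j^-(x;t)=\sum_{n\ge0}\sum_{i<0}a_{i,j}(n)x^it^n$. Consequently, for every $(i,j)\in\mathbb{Z}^2$, the series $S_{i,j}(t)=\sum_{n\ge0}a_{i,j}(n)t^n$ belongs to $\mathbb{Q}_A$ (and is algebraic over $\mathbb{Q}(t)$).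
   Context: $\mathcal H=\{(k,0):k\le0\}$; $A\subset\mathbb{Z}^2$ finite, symmetric ($(i,j)\in A\Rightarrow(i,-j)\in A$), with small height variations ($|j|\le1$ for $(i,j)\in A$), and $A_1\neq0$. A walk on the slit plane with steps in $A$ is $(w_0,\dots,w_n)$ with $w_0=(0,0)$, $w_m-w_{m-1}\in A$, $w_m\notin\mathcal H$ for $1\le m\le n$; $a_{i,j}(n)$ counts those of length $n$ ending at $(i,j)$. $\bar x=1/x$, $A_0(x)=\sum_{(i,0)\in A}x^i$, $A_1(x)=\sum_{(i,1)\in A}x^i$, $\delta(x)=(1-tA_0(x)-2tA_1(x))(1-tA_0(x)+2tA_1(x))$, and $(D,\Delta(x),\bar\Delta(\bar x))$ is its canonical factorization: the unique triple of formal power series in $t$ with $\delta=D\Delta(x)\bar\Delta(\bar x)$, $D$ real coefficients, $\Delta(x)$ coefficients in $\mathbb{R}[x]$, $\bar\Delta(\bar x)$ coefficients in $\mathbb{R}[\bar x]$, $D(0)=\Delta(0;t)=\bar\Delta(0;t)=\Delta(x;0)=\bar\Delta(\bar x;0)=1$ (then $\Delta$, $\bar\Delta$ are polynomials in $x$, resp. $\bar x$, with algebraic series coefficients). Define $f_j^+=\sum_{k=0}^{\lfloor j/2\rfloor}\binom j{2k}\delta^k(1-tA_0)^{j-2k}$ and $f_j^-=\sum_{k=0}^{\lfloor(j-1)/2\rfloor}\binom j{2k+1}\delta^k(1-tA_0)^{j-2k-1}$. Let $m$ be the least integer such that $x^mA_1(x)$ is a polynomial, and $\alpha_1,\dots,\alpha_d$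 its (nonzero) complex roots. $\mathbb{Q}_A$ is the field generated over $\mathbb{Q}(t)$ by $\sqrt D$, the coefficients of $\Delta(x)$ and of $\bar\Delta(\bar x)$ (as polynomials in $x$, resp. $\bar x$), the numbers $\alpha_i$, and the series $\sqrt{\Delta(\alpha_i)}$. Square roots are series with constant term $1$. *)

theory Defs
  imports "HOL-Computational_Algebra.Computational_Algebra"
begin

definition wpos :: "(int \<times> int) list \<Rightarrow> nat \<Rightarrow> int \<times> int" where
  "wpos ws m = ((\<Sum>s\<leftarrow>take m ws. fst s), (\<Sum>s\<leftarrow>take m ws. snd s))"

definition slit :: "(int \<times> int) set" where
  "slit = {(k, 0) | k. k \<le> 0}"

definition slit_walks :: "(int \<times> int) set \<Rightarrow> nat \<Rightarrow> (int \<times> int) list set" where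
  "slit_walks A n = {ws. length ws = n \<and> set ws \<subseteq> A \<and> (\<forall>m\<in>{1..n}. wpos ws m \<notin> slit)}"

definition acount :: "(int \<times> int) set \<Rightarrow> int \<Rightarrow> int \<Rightarrow> nat \<Rightarrow> nat" where
  "acount A i j n = card {ws \<in> slit_walks A n. wpos ws n = (i, j)}"

(* ---------- Bivariate series ----------
   Type complex fls fls: Laurent series in t (outer) whose coefficients are
   Laurent series in x (inner). *)

abbreviation tvar :: "complex fls fls" where "tvar \<equiv> fls_X"

definition xpow :: "int \<Rightarrow> complex fls fls" where
  "xpow k = fls_const (fls_X_intpow k)"

definition tembed :: "complex fls \<Rightarrow> complex fls fls" where
  "tembed e = Abs_fls (\<lambda>n. fls_const (fls_nth e n))"

definition xcoeff :: "complex fls fls \<Rightarrow> int \<Rightarrow> complex fls" where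
  "xcoeff F k = Abs_fls (\<lambda>n. fls_nth (fls_nth F n) k)"

(* evaluation at x = alpha of a series in t whose coefficients are Laurent polynomials in x *)
definition evalx :: "complex fls fls \<Rightarrow> complex \<Rightarrow> complex fls" where
  "evalx F \<alpha> = Abs_fls (\<lambda>n. (\<Sum>k | fls_nth (fls_nth F n) k \<noteq> 0. fls_nth (fls_nth F n) k * \<alpha> powi k))"

definition fsqrt :: "'a::comm_ring_1 fls \<Rightarrow> 'a fls" where
  "fsqrt a = (THE s. s * s = a \<and> (\<forall>n<0. fls_nth s n = 0) \<and> fls_nth s 0 = 1)"

definition Apoly :: "(int \<times> int) set \<Rightarrow> int \<Rightarrow> complex fls fls" where
  "Apoly A h = (\<Sum>i\<in>{i. (i, h) \<in> A}. xpow i)"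

definition deltaA :: "(int \<times> int) set \<Rightarrow> complex fls fls" where
  "deltaA A = (1 - tvar * Apoly A 0 - 2 * tvar * Apoly A 1) * (1 - tvar * Apoly A 0 + 2 * tvar * Apoly A 1)"

definition fplus :: "(int \<times> int) set \<Rightarrow> nat \<Rightarrow> complex fls fls" where
  "fplus A j = (\<Sum>k = 0..j div 2. of_nat (j choose (2*k)) * deltaA A ^ k * (1 - tvar * Apoly A 0) ^ (j - 2*k))"

definition fminus :: "(int \<times> int) set \<Rightarrow> nat \<Rightarrow> complex fls fls" where
  "fminus A j = (if j = 0 then 0 else
     (\<Sum>k = 0..(j - 1) div 2. of_nat (j choose (2*k+1)) * deltaA A ^ k * (1 - tvar * Apoly A 0) ^ (j - 2*k - 1)))"

definition Splus :: "(int \<times> int) set \<Rightarrow> int \<Rightarrow> complex fls fls" where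
  "Splus A j = fps_to_fls (Abs_fps (\<lambda>n. fps_to_fls (Abs_fps (\<lambda>i. of_nat (acount A (int i) j n)))))"

definition Sminus :: "(int \<times> int) set \<Rightarrow> int \<Rightarrow> complex fls fls" where
  "Sminus A j = fps_to_fls (Abs_fps (\<lambda>n. Abs_fls (\<lambda>i. if i < 0 then of_nat (acount A i j n) else 0)))"

definition Sij :: "(int \<times> int) set \<Rightarrow> int \<Rightarrow> int \<Rightarrow> complex fls" where
  "Sij A i j = fps_to_fls (Abs_fps (\<lambda>n. of_nat (acount A i j n)))"

definition canonical_factorization ::
  "(int \<times> int) set \<Rightarrow> complex fls fls \<Rightarrow> complex fls fls \<Rightarrow> complex fls fls \<Rightarrow> bool" where
  "canonical_factorization A D Dl Dlb \<longleftrightarrow>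
     deltaA A = D * Dl * Dlb \<and>
     \<comment> \<open>D: power series in t with real constant (in x) coefficients, D(0) = 1\<close>
     (\<forall>n. \<exists>c\<in>\<real>. fls_nth D n = fls_const c) \<and> (\<forall>n<0. fls_nth D n = 0) \<and> fls_nth D 0 = 1 \<and>
     \<comment> \<open>Delta(x): power series in t with coefficients in R[x]\<close>
     (\<forall>n<0. fls_nth Dl n = 0) \<and>
     (\<forall>n k. fls_nth (fls_nth Dl n) k \<in> \<real>) \<and> (\<forall>n. \<forall>k<0. fls_nth (fls_nth Dl n) k = 0) \<and>
     (\<forall>n. finite {k. fls_nth (fls_nth Dl n) k \<noteq> 0}) \<and>
     \<comment> \<open>Delta(0;t) = 1 and Delta(x;0) = 1\<close>
     (\<forall>n. fls_nth (fls_nth Dl n) 0 = (if n = 0 then 1 else 0)) \<and> fls_nth Dl 0 = 1 \<and>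
     \<comment> \<open>bar Delta(bar x): power series in t with coefficients in R[bar x]\<close>
     (\<forall>n<0. fls_nth Dlb n = 0) \<and>
     (\<forall>n k. fls_nth (fls_nth Dlb n) k \<in> \<real>) \<and> (\<forall>n. \<forall>k>0. fls_nth (fls_nth Dlb n) k = 0) \<and>
     (\<forall>n. finite {k. fls_nth (fls_nth Dlb n) k \<noteq> 0}) \<and>
     (\<forall>n. fls_nth (fls_nth Dlb n) 0 = (if n = 0 then 1 else 0)) \<and> fls_nth Dlb 0 = 1"

definition is_subfield :: "'a::field set \<Rightarrow> bool" where
  "is_subfield K \<longleftrightarrow> 0 \<in> K \<and> 1 \<in> K \<and>
     (\<forall>a\<in>K. \<forall>b\<in>K. a + b \<in> K \<and> a * b \<in> K) \<and> (\<forall>a\<in>K. - a \<in> K) \<and>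
     (\<forall>a\<in>K. a \<noteq> 0 \<longrightarrow> inverse a \<in> K)"

definition gen_field :: "'a::field set \<Rightarrow> 'a set" where
  "gen_field S = \<Inter> {K. is_subfield K \<and> S \<subseteq> K}"

definition ratfuns :: "complex fls set" where
  "ratfuns = {fps_to_fls (fps_of_poly (map_poly of_rat p)) / fps_to_fls (fps_of_poly (map_poly of_rat q))
              | p q. q \<noteq> 0}"

definition alphas :: "(int \<times> int) set \<Rightarrow> complex set" where
  "alphas A = {\<alpha>. \<alpha> \<noteq> 0 \<and> (\<Sum>i\<in>{i. (i, 1) \<in> A}. \<alpha> powi i) = 0}"

definition QA :: "(int \<times> int) set \<Rightarrow> complex fls fls \<Rightarrow> complex fls fls \<Rightarrow> complex fls fls \<Rightarrow> complex fls set" where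
  "QA A D Dl Dlb = gen_field (ratfuns \<union> {fsqrt (xcoeff D 0)}
      \<union> (\<lambda>k. xcoeff Dl (int k)) ` UNIV \<union> (\<lambda>k. xcoeff Dlb (- int k)) ` UNIV
      \<union> fls_const ` alphas A \<union> (\<lambda>\<alpha>. fsqrt (evalx Dl \<alpha>)) ` alphas A)"

definition algebraic_over_Qt :: "complex fls \<Rightarrow> bool" where
  "algebraic_over_Qt s \<longleftrightarrow> (\<exists>p :: complex fls poly. p \<noteq> 0 \<and> (\<forall>i. coeff p i \<in> ratfuns) \<and> poly p s = 0)"

end

theory Submission
  imports Defs "HOL-Algebra.Algebraic_Closure_Type"
begin

text \<open>
  Write $u = 1 - t A_0$, $c = 2 t A_1$, so that $\delta = u^2 - c^2$, and let $S_j$ be the series of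
  walks ending at height $j$. Away from the slit, $c\,S_{j+2} = 2 u\,S_{j+1} - c\,S_j$; since $c$ is
  divisible by $t$ and $u + \sqrt\delta$ is a unit, the only solution is
  $c\,S_{j+1} = (u - \sqrt\delta)\,S_j$. On the slit this makes $\sqrt\delta\,S_0$ a series in
  $1/x$; splitting $\sqrt\delta = \sqrt\Delta \cdot \sqrt{D \bar\Delta}$, the series
  $S_0 \sqrt\Delta$ contains neither negative nor positive powers of $x$, hence is $1$. So
  $c^j S_j = (u - \sqrt\delta)^j / \sqrt\Delta = f_j^+/\sqrt\Delta - f_j^- \sqrt{D \bar\Delta}$,
  and $g_j = f_j^+/\sqrt\Delta - c^j S_j^+ = f_j^-\sqrt{D\bar\Delta} + c^j S_j^-$ is bounded in
  $x$-degree on both sides.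

  Its coefficients outside the exponent range of $A_1^j$ are coefficients of the explicit part. The
  remaining ones number exactly the degree of $A_1^j$, and they are determined modulo $A_1^j$ by
  $f_j^+/\sqrt\Delta$, whose residue is computed over $Q_A$ by Newton interpolation at the roots
  of $A_1$. Finally, every root of $\Delta$ or $\bar\Delta$ in an algebraic closure is a root
  of $\delta$, so $Q_A$ is algebraic over $Q(t)$.
\<close>

hide_const (open) module.smult up_ring.monom up_ring.coeff Polynomials.degree
  Polynomials.lead_coeff

subsection \<open>Elements algebraic over a subfield\<close>

definition algebraic_elements :: "'a::field set \<Rightarrow> 'a set" where
  "algebraic_elements K = {s. \<exists>p. p \<noteq> 0 \<and> (\<forall>i. poly.coeff p i \<in> K) \<and> poly p s = 0}"

lemma is_subfieldD:
  assumes "is_subfield K"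
  shows "0 \<in> K" "1 \<in> K" "a \<in> K \<Longrightarrow> b \<in> K \<Longrightarrow> a + b \<in> K" "a \<in> K \<Longrightarrow> b \<in> K \<Longrightarrow> a * b \<in> K"
    "a \<in> K \<Longrightarrow> - a \<in> K" "a \<in> K \<Longrightarrow> inverse a \<in> K"
  using assms unfolding is_subfield_def by simp_all (cases "a = 0"; simp)+

context
  fixes R :: "'a::field ring"
  defines "R \<equiv> ring_of_type_algebra"
begin

interpretation R: Ring.field R
  unfolding R_def by (rule field_from_type_algebra)

lemma type_ring_simps:
  "carrier R = UNIV" "\<zero>\<^bsub>R\<^esub> = 0" "\<one>\<^bsub>R\<^esub> = 1" "x \<oplus>\<^bsub>R\<^esub> y = x + y" "x \<otimes>\<^bsub>R\<^esub> y = x * y"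
  by (simp_all add: R_def ring_of_type_algebra_def)

lemma type_ring_uminus: "\<ominus>\<^bsub>R\<^esub> x = - x"
  using R.l_neg[of x] by (simp add: type_ring_simps eq_neg_iff_add_eq_0)

lemma type_ring_inv: "x \<noteq> 0 \<Longrightarrow> inv\<^bsub>R\<^esub> x = inverse x"
  using R.comm_inv_char[of x "inverse x"] by (simp add: type_ring_simps)

lemma type_ring_pow: "x [^]\<^bsub>R\<^esub> (n::nat) = x ^ n"
  by (induction n) (simp_all add: type_ring_simps)

text \<open>HOL-Algebra stores a polynomial as a list with the leading coefficient first,
  \<open>Poly\<close> expects the constant term first; hence the reversal.\<close>

lemma type_ring_eval: "R.eval p x = poly (Poly (rev p)) x"
  by (induction p) (simp_all add: type_ring_simps type_ring_pow Poly_append poly_monom)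

lemma is_subfield_iff: "is_subfield K \<longleftrightarrow> subfield K R"
proof
  assume K: "is_subfield K"
  show "subfield K R"
  proof (rule R.subfieldI')
    show "subring K R"
      using is_subfieldD[OF K] by (intro R.subringI) (auto simp: type_ring_simps type_ring_uminus)
    show "inv\<^bsub>R\<^esub> k \<in> K" if "k \<in> K - {\<zero>\<^bsub>R\<^esub>}" for k
      using that is_subfieldD[OF K] by (simp add: type_ring_simps type_ring_inv)
  qed
next
  assume K: "subfield K R"
  have "inverse a \<in> K" if "a \<in> K" "a \<noteq> 0" for a
    using R.subfield_m_inv(1)[OF K, of a] that by (simp add: type_ring_simps type_ring_inv)
  then show "is_subfield K"
    using subringE[OF subfieldE(1)[OF K]] by (auto simp: is_subfield_def type_ring_simps type_ring_uminus)
qed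

lemma algebraic_elements_iff:
  assumes K: "is_subfield K"
  shows "x \<in> algebraic_elements K \<longleftrightarrow> (R.algebraic over K) x"
proof
  assume "x \<in> algebraic_elements K"
  then obtain p where p: "p \<noteq> 0" "\<forall>i. poly.coeff p i \<in> K" "poly p x = 0"
    unfolding algebraic_elements_def by auto
  have "rev (coeffs p) \<in> carrier (univ_poly R K)"
    using p by (auto simp: univ_poly_def polynomial_def type_ring_simps hd_rev last_coeffs_eq_coeff_degree
        coeffs_def)
  moreover have "R.eval (rev (coeffs p)) x = \<zero>\<^bsub>R\<^esub>"
    using p by (simp add: type_ring_eval type_ring_simps)
  ultimately show "(R.algebraic over K) x"
    using R.algebraicI[of "rev (coeffs p)" K x] p by (simp add: over_def)
next
  assume "(R.algebraic over K) x"
  then obtain p where p: "p \<in> carrier (univ_poly R K)" "p \<noteq> []" "R.eval p x = \<zero>\<^bsub>R\<^esub>"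
    using R.algebraicE[OF subfieldE(1)[OF iffD1[OF is_subfield_iff K]], of x] by (auto simp: type_ring_simps)
  have 1: "set p \<subseteq> K" "hd p \<noteq> 0"
    using p by (auto simp: univ_poly_def polynomial_def type_ring_simps)
  have "poly.coeff (Poly (rev p)) (length p - 1) = hd p"
    using p(2) by (simp add: nth_default_def rev_nth hd_conv_nth)
  with 1 have "Poly (rev p) \<noteq> 0"
    by (metis coeff_0)
  moreover have "poly.coeff (Poly (rev p)) i \<in> K" for i
    using 1 is_subfieldD(1)[OF K] nth_mem[of _ "rev p"] by (auto simp: nth_default_def simp del: nth_mem)
  ultimately show "x \<in> algebraic_elements K"
    using p(3) by (auto simp: algebraic_elements_def type_ring_eval type_ring_simps)
qed

text \<open>Closure under the field operations comes from the theory of field extensions in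
  HOL-Algebra; the lemmas above turn the field type into a ring record to which that theory
  applies.\<close>

lemma is_subfield_algebraic_elements:
  fixes K :: "'a set"
  assumes K: "is_subfield K"
  shows "is_subfield (algebraic_elements K)"
proof -
  have "algebraic_elements K = {x \<in> carrier R. (R.algebraic over K) x}"
    using algebraic_elements_iff[OF K] by (auto simp: type_ring_simps)
  then show ?thesis
    using R.subfield_of_algebraics[of K] K by (simp add: is_subfield_iff)
qed

end

text \<open>Subrings are sets here because the same closure rules serve very different rings:
  subfields of series in t, exponent conditions on Laurent series, series and polynomials over
  these, and series with a prescribed kind of residue.\<close>

locale subring_set =
  fixes R :: "'a::comm_ring_1 set"
  assumes zero_mem [simp, intro]: "0 \<in> R"
    and one_mem [simp, intro]: "1 \<in> R"
    and add_mem [intro]: "a \<in> R \<Longrightarrow> b \<in> R \<Longrightarrow> a + b \<in> R"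
    and mult_mem [intro]: "a \<in> R \<Longrightarrow> b \<in> R \<Longrightarrow> a * b \<in> R"
    and uminus_mem [intro]: "a \<in> R \<Longrightarrow> - a \<in> R"
begin

lemma diff_mem [intro]: "a \<in> R \<Longrightarrow> b \<in> R \<Longrightarrow> a - b \<in> R"
  using add_mem[of a "- b"] by auto

lemma sum_mem [intro]: "(\<And>i. i \<in> I \<Longrightarrow> f i \<in> R) \<Longrightarrow> sum f I \<in> R"
  by (induction I rule: infinite_finite_induct) auto

lemma power_mem [intro]: "a \<in> R \<Longrightarrow> a ^ n \<in> R"
  by (induction n) auto

lemma of_nat_mem [simp, intro]: "of_nat n \<in> R"
  by (induction n) auto

lemma numeral_mem [simp, intro]: "numeral n \<in> R"
  using of_nat_mem[of "numeral n"] by simp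

lemma poly_mem: "(\<And>i. poly.coeff p i \<in> R) \<Longrightarrow> x \<in> R \<Longrightarrow> poly p x \<in> R"
  by (auto simp: poly_altdef)

end

lemma subring_set_of_subfield: "is_subfield K \<Longrightarrow> subring_set K"
  by unfold_locales (auto intro: is_subfieldD)

definition poly_over :: "'a::comm_ring_1 set \<Rightarrow> 'a poly set" where
  "poly_over R = {p. \<forall>i. poly.coeff p i \<in> R}"

lemma poly_over_coeff: "p \<in> poly_over R \<Longrightarrow> poly.coeff p i \<in> R"
  by (simp add: poly_over_def)

lemma (in subring_set) pCons_mem_poly_over_iff [simp]:
  "pCons a p \<in> poly_over R \<longleftrightarrow> a \<in> R \<and> p \<in> poly_over R"
  unfolding poly_over_def by (auto simp: coeff_pCons split: nat.splits)

lemma (in subring_set) subring_set_poly_over: "subring_set (poly_over R)"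
  by unfold_locales (auto simp: poly_over_def coeff_mult coeff_1 intro!: sum_mem)

lemma (in subring_set) zero_mem_poly_over [simp, intro]: "0 \<in> poly_over R"
  by (simp add: poly_over_def)

lemma (in subring_set) smult_mem_poly_over [intro]:
  "c \<in> R \<Longrightarrow> p \<in> poly_over R \<Longrightarrow> smult c p \<in> poly_over R"
  by (auto simp: poly_over_def)

text \<open>The divisor is monic, so the Horner scheme uses ring operations only and needs no
  inverses in \<open>R\<close>.\<close>

lemma (in subring_set) synthetic_div_mem_poly_over:
  assumes "p \<in> poly_over R" "c \<in> R"
  shows "synthetic_div p c \<in> poly_over R"
  using assms(1)
proof (induction p)
  case (pCons a p)
  then show ?case
    using assms(2) poly_mem[of p c] by (auto simp: synthetic_div_pCons poly_over_coeff)
qed simp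

lemma synthetic_div_linear_mult: "synthetic_div ([:- c, 1:] * q) c = q"
  for c :: "'a::comm_ring_1"
proof -
  have "poly ([:- c, 1:] * q) c = 0"
    by simp
  then have "[:- c, 1:] * q + smult c q = pCons 0 q"
    by simp
  from synthetic_div_unique[of "[:- c, 1:] * q" c q 0] this show ?thesis
    by simp
qed

text \<open>Synthetic division recovers \<open>q\<close> from the product. Iterated along a list of
  roots, this cancels a whole root polynomial without leaving the subring.\<close>

lemma (in subring_set) linear_mult_mem_poly_over_iff:
  assumes "c \<in> R"
  shows "[:- c, 1:] * q \<in> poly_over R \<longleftrightarrow> q \<in> poly_over R"
proof
  assume "[:- c, 1:] * q \<in> poly_over R"
  from synthetic_div_mem_poly_over[OF this assms] show "q \<in> poly_over R"
    by (simp only: synthetic_div_linear_mult)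
next
  interpret P: subring_set "poly_over R" by (rule subring_set_poly_over)
  assume "q \<in> poly_over R"
  then show "[:- c, 1:] * q \<in> poly_over R"
    using assms by (intro P.mult_mem) auto
qed

section \<open>Passage to the algebraic closure and back\<close>

lemma map_poly_to_ac_mult: "map_poly to_ac (p * q) = map_poly to_ac p * map_poly to_ac q"
  by (rule poly_eqI) (simp add: coeff_map_poly coeff_mult to_ac_sum)

lemma poly_map_poly_to_ac: "poly (map_poly to_ac p) (to_ac x) = to_ac (poly p x)"
  by (induction p) (simp_all add: map_poly_pCons)

lemma is_subfield_to_ac_image: "is_subfield K \<Longrightarrow> is_subfield (to_ac ` K)"
  unfolding is_subfield_def
  by (auto simp flip: to_ac_add to_ac_mult to_ac_minus to_ac_inverse to_ac_0 to_ac_1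
      simp del: to_ac_add to_ac_mult to_ac_minus to_ac_inverse to_ac_0 to_ac_1)

text \<open>The embedding is injective, so an annihilating polynomial with coefficients in the image
  of \<open>K\<close> pulls back to one over \<open>K\<close>.\<close>

lemma to_ac_mem_algebraic_elements:
  assumes "0 \<in> K" "to_ac x \<in> algebraic_elements (to_ac ` K)"
  shows "x \<in> algebraic_elements K"
proof -
  obtain p where p: "p \<noteq> 0" "\<And>i. poly.coeff p i \<in> to_ac ` K" "poly p (to_ac x) = 0"
    using assms by (auto simp: algebraic_elements_def)
  define q where "q = map_poly of_ac p"
  have p_eq: "p = map_poly to_ac q"
    using p(2) by (intro poly_eqI) (metis (no_types, lifting) coeff_map_poly imageE of_ac_0 of_ac_to_ac q_def to_ac_0)
  have "poly.coeff q i \<in> K" for i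
    using p(2)[of i] by (auto simp: q_def coeff_map_poly)
  moreover have "q \<noteq> 0" "poly q x = 0"
    using p by (auto simp: p_eq poly_map_poly_to_ac)
  ultimately show ?thesis
    by (auto simp: algebraic_elements_def)
qed

text \<open>The roots of the factor in the algebraic closure are roots of the multiple, hence algebraic;
  the factor is recovered from its roots up to a scalar, which the normalised coefficient fixes.\<close>
lemma factor_coeff_algebraic:
  fixes p q :: "'a::field poly"
  assumes K: "is_subfield K" and dvd: "p dvd q" and q: "q \<noteq> 0" "q \<in> poly_over K"
    and pm: "poly.coeff p m = 1"
  shows "poly.coeff p i \<in> algebraic_elements K"
proof -
  define L where "L = algebraic_elements (to_ac ` K)"
  have L: "is_subfield L"
    unfolding L_def by (intro is_subfield_algebraic_elements is_subfield_to_ac_image K)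
  interpret L: subring_set L by (rule subring_set_of_subfield[OF L])
  interpret PL: subring_set "poly_over L" by (rule L.subring_set_poly_over)
  define P where "P = map_poly to_ac p"
  obtain r where r: "q = p * r" using dvd by (elim dvdE)
  have root: "x \<in> L" if "poly P x = 0" for x
  proof -
    have "poly (map_poly to_ac q) x = 0"
      using that by (simp add: r map_poly_to_ac_mult P_def)
    moreover have "poly.coeff (map_poly to_ac q) i \<in> to_ac ` K" for i
      using q(2) by (auto simp: coeff_map_poly poly_over_def)
    moreover have "map_poly to_ac q \<noteq> 0"
      using q(1) by (simp add: map_poly_eq_0_iff)
    ultimately show ?thesis
      by (auto simp: L_def algebraic_elements_def)
  qed
  have "p \<noteq> 0" using pm by auto
  then have "P \<noteq> 0" by (simp add: P_def map_poly_eq_0_iff)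
  then obtain A where A: "P = smult (Polynomial.lead_coeff P) (\<Prod>x\<in>#A. [:- x, 1:])"
    using alg_closed_imp_factorization[of P] by metis
  define Q where "Q = (\<Prod>x\<in>#A. [:- x, 1:])"
  have AL: "x \<in> L" if "x \<in># A" for x
  proof (rule root)
    have "[:- x, 1:] dvd Q" 
      unfolding Q_def using that by (intro dvd_prod_mset) auto
    then show "poly P x = 0"
      by (subst A) (simp add: Q_def[symmetric] poly_eq_0_iff_dvd)
  qed
  have "Q \<in> poly_over L"
    using AL unfolding Q_def by (induction A) (auto intro!: PL.diff_mem L.smult_mem_poly_over)
  moreover have "Polynomial.lead_coeff P = inverse (poly.coeff Q m)"
  proof -
    have "1 = poly.coeff P m"
      by (simp add: P_def coeff_map_poly pm)
    also have "\<dots> = Polynomial.lead_coeff P * poly.coeff Q m"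
      by (subst A) (simp add: Q_def)
    finally show ?thesis
      by (metis inverse_unique mult.commute)
  qed
  ultimately have "poly.coeff P i \<in> L"
    by (subst A) (auto simp: Q_def[symmetric] poly_over_def intro: is_subfieldD[OF L])
  then have "to_ac (poly.coeff p i) \<in> L"
    by (simp add: P_def coeff_map_poly)
  then show ?thesis
    using to_ac_mem_algebraic_elements is_subfieldD(1)[OF K] unfolding L_def by blast
qed

text \<open>If \<open>p\<close> annihilates $s^2$, then $p(X^2)$ annihilates
  \<open>s\<close>.\<close>

lemma sqrt_mem_algebraic_elements:
  assumes K: "is_subfield K" and s: "s * s \<in> algebraic_elements K"
  shows "s \<in> algebraic_elements K"
proof -
  obtain p where p: "p \<noteq> 0" "\<And>i. poly.coeff p i \<in> K" "poly p (s * s) = 0"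
    using s by (auto simp: algebraic_elements_def)
  interpret subring_set K by (rule subring_set_of_subfield[OF K])
  interpret P: subring_set "poly_over K" by (rule subring_set_poly_over)
  have sq: "monom 1 2 \<in> poly_over K" by (simp add: poly_over_def)
  have "p \<in> poly_over K" using p(2) by (simp add: poly_over_def)
  then have "pcompose p (monom 1 2) \<in> poly_over K"
    by (induction p) (auto simp: pcompose_pCons sq intro!: P.add_mem P.mult_mem)
  moreover have "pcompose p (monom 1 2) \<noteq> 0"
    using p(1) by (simp add: pcompose_eq_0_iff degree_monom_eq)
  moreover have "poly (pcompose p (monom 1 2)) s = 0"
    using p(3) by (simp add: poly_pcompose poly_monom power2_eq_square)
  ultimately show ?thesis
    by (auto simp: algebraic_elements_def poly_over_def)
qed

unbundle fps_syntax
notation fls_nth (infixl \<open>$$\<close> 75)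

text \<open>The library sums over an interval given by subdegrees. A freely chosen finite index set
  allows the actual support of the factors, on either side, to decide which products occur.\<close>

lemma fls_times_nth_superset:
  fixes f g :: "'a::semiring_0 fls"
  assumes "finite I" "\<And>i. f $$ i * g $$ (n - i) \<noteq> 0 \<Longrightarrow> i \<in> I"
  shows "(f * g) $$ n = (\<Sum>i\<in>I. f $$ i * g $$ (n - i))"
proof -
  let ?J = "{fls_subdegree f..n - fls_subdegree g}"
  have "(f * g) $$ n = (\<Sum>i\<in>?J. f $$ i * g $$ (n - i))"
    by (rule fls_times_nth(2))
  also have "\<dots> = (\<Sum>i\<in>?J \<union> I. f $$ i * g $$ (n - i))"
    using assms(1) by (intro sum.mono_neutral_left) auto
  also have "\<dots> = (\<Sum>i\<in>I. f $$ i * g $$ (n - i))"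
    using assms by (intro sum.mono_neutral_right) auto
  finally show ?thesis .
qed

subsection \<open>Coefficients in a subring\<close>

context subring_set
begin

text \<open>The coefficients of the quotient are found recursively, dividing only by the constant
  term of \<open>f\<close>. Its inverse \<open>u\<close> is an explicit parameter since
  \<open>R\<close> is used both for fields and for rings of Laurent series with restricted
  exponents.\<close>

lemma fps_quotient_coeff_mem:
  fixes f s :: "'a fps"
  assumes f: "\<And>n. f $ n \<in> R" and fs: "\<And>n. (f * s) $ n \<in> R"
    and unit: "u \<in> R" "u * f $ 0 = 1"
  shows "s $ n \<in> R"
proof (induction n rule: less_induct)
  case (less n)
  have "(f * s) $ n = f $ 0 * s $ n + (\<Sum>i = Suc 0..n. f $ i * s $ (n - i))"
    by (simp add: fps_mult_nth sum.atLeast_Suc_atMost)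
  then have "u * f $ 0 * s $ n = u * ((f * s) $ n - (\<Sum>i = Suc 0..n. f $ i * s $ (n - i)))"
    by (simp add: algebra_simps)
  moreover have "(\<Sum>i = Suc 0..n. f $ i * s $ (n - i)) \<in> R"
    using f less by (intro sum_mem mult_mem) auto
  ultimately show ?case
    using unit fs by (auto intro!: mult_mem diff_mem)
qed

text \<open>In the coefficient \<open>n > 0\<close> of $s^2$ the unknown $s_n$ occurs only as $2 s_0
  s_n$, so it can be solved for once $2 s_0$ has an inverse in \<open>R\<close>.\<close>

lemma fps_sqrt_coeff_mem:
  fixes s :: "'a fps"
  assumes ss: "\<And>n. (s * s) $ n \<in> R" and s0: "s $ 0 \<in> R"
    and unit: "u \<in> R" "u * (2 * s $ 0) = 1"
  shows "s $ n \<in> R"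
proof (induction n rule: less_induct)
  case (less n)
  show ?case
  proof (cases "n = 0")
    case False
    then have eq: "{0..n} = insert 0 (insert n {0<..<n})" by auto
    have "(s * s) $ n = 2 * s $ 0 * s $ n + (\<Sum>i\<in>{0<..<n}. s $ i * s $ (n - i))"
      using False by (simp add: fps_mult_nth eq algebra_simps)
    then have "u * (2 * s $ 0) * s $ n = u * ((s * s) $ n - (\<Sum>i\<in>{0<..<n}. s $ i * s $ (n - i)))"
      by (simp add: algebra_simps)
    moreover have "(\<Sum>i\<in>{0<..<n}. s $ i * s $ (n - i)) \<in> R"
      using less by (intro sum_mem mult_mem) auto
    ultimately show ?thesis
      using unit ss by (auto intro!: mult_mem diff_mem)
  qed (use s0 in simp)
qed

end

section \<open>Square roots of series with constant term 1\<close>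

function fps_sqrt_coeff :: "'a::field_char_0 fps \<Rightarrow> nat \<Rightarrow> 'a" where
  "fps_sqrt_coeff a n = (if n = 0 then 1 else
     (a $ n - (\<Sum>i\<in>{0<..<n}. fps_sqrt_coeff a i * fps_sqrt_coeff a (n - i))) / 2)"
  by auto
termination by (relation "measure snd") auto

declare fps_sqrt_coeff.simps [simp del]

lemma fps_sqrt_exists:
  fixes a :: "'a::field_char_0 fps"
  assumes "a $ 0 = 1"
  obtains s where "s * s = a" "s $ 0 = 1"
proof
  let ?s = "Abs_fps (fps_sqrt_coeff a)"
  show "?s * ?s = a"
  proof (rule fps_ext)
    fix n
    show "(?s * ?s) $ n = a $ n"
    proof (cases "n = 0")
      case False
      then have eq: "{0..n} = insert 0 (insert n {0<..<n})" by auto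
      show ?thesis
        using False by (simp add: fps_mult_nth eq fps_sqrt_coeff.simps[of a n] fps_sqrt_coeff.simps[of a 0])
    qed (use assms in \<open>simp add: fps_sqrt_coeff.simps\<close>)
  qed
  show "?s $ 0 = 1" by (simp add: fps_sqrt_coeff.simps)
qed

lemma fps_to_fls_regpart: "(\<forall>n<0. F $$ n = 0) \<Longrightarrow> fps_to_fls (fls_regpart F) = F"
  by (rule fls_eqI) auto

text \<open>\<open>fsqrt\<close> is a definite description, so uniqueness must be shown: two
  candidates satisfy $(r - s)(r + s) = 0$, and $r + s$ has constant term 2.\<close>

lemma fsqrt_eqI:
  fixes a :: "'a::field_char_0 fls"
  assumes "s * s = a" "\<forall>n<0. s $$ n = 0" "s $$ 0 = 1"
  shows "fsqrt a = s"
  unfolding fsqrt_def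
proof (rule the_equality)
  fix r assume r: "r * r = a \<and> (\<forall>n<0. r $$ n = 0) \<and> r $$ 0 = 1"
  have "(r - s) * (r + s) = 0"
    using r assms by (simp add: algebra_simps)
  moreover have "(r + s) $$ 0 \<noteq> 0"
    using r assms by simp
  then have "r + s \<noteq> 0" by (metis fls_zero_nth)
  ultimately show "r = s" by simp
qed (use assms in auto)

lemma fsqrt_props:
  fixes a :: "'a::field_char_0 fls"
  assumes "\<forall>n<0. a $$ n = 0" "a $$ 0 = 1"
  shows "fsqrt a * fsqrt a = a" "\<forall>n<0. fsqrt a $$ n = 0" "fsqrt a $$ 0 = 1"
proof -
  obtain s where s: "s * s = fls_regpart a" "s $ 0 = 1"
    using fps_sqrt_exists[of "fls_regpart a"] assms by auto
  have "fsqrt a = fps_to_fls s"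
  proof (rule fsqrt_eqI)
    show "fps_to_fls s * fps_to_fls s = a"
      using fps_to_fls_regpart[OF assms(1)] s by (simp flip: fls_times_fps_to_fls)
  qed (use s in auto)
  then show "fsqrt a * fsqrt a = a" "\<forall>n<0. fsqrt a $$ n = 0" "fsqrt a $$ 0 = 1"
    using s fps_to_fls_regpart[OF assms(1)] by (auto simp flip: fls_times_fps_to_fls)
qed

text \<open>With \<open>R\<close> a ring of Laurent series in x cut out by its exponents, an
  exponent condition on a series in t becomes membership in a subring.\<close>

definition fls_over :: "'a::comm_ring_1 set \<Rightarrow> 'a fls set" where
  "fls_over R = {F. \<forall>n. F $$ n \<in> R}"

context subring_set
begin

lemma subring_set_fls_over: "subring_set (fls_over R)"
  by unfold_locales (auto simp: fls_over_def fls_times_nth(2) intro!: sum_mem)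

lemma fls_const_mem_fls_over_iff [simp]: "fls_const c \<in> fls_over R \<longleftrightarrow> c \<in> R"
  by (auto simp: fls_over_def)

lemma fls_X_mem_fls_over [simp, intro]: "fls_X \<in> fls_over R"
  by (auto simp: fls_over_def)

lemma mem_fls_overI:
  assumes "\<forall>n<0. s $$ n = 0" "\<And>n. fls_regpart s $ n \<in> R"
  shows "s \<in> fls_over R"
  unfolding fls_over_def
proof safe
  fix n
  show "s $$ n \<in> R"
    using assms(1) assms(2)[of "nat n"] by (cases "n < 0") auto
qed

text \<open>Dividing by a series in t with constant term 1 preserves conditions on the exponents of
  x; this is how bounds on a product pass to one factor.\<close>

lemma fls_quotient_mem_fls_over:
  assumes "f \<in> fls_over R" "f * s \<in> fls_over R" "\<forall>n<0. f $$ n = 0" "f $$ 0 = 1"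
    "\<forall>n<0. s $$ n = 0"
  shows "s \<in> fls_over R"
proof -
  have "f * s = fps_to_fls (fls_regpart f * fls_regpart s)"
    using assms by (simp add: fls_times_fps_to_fls fps_to_fls_regpart)
  then have fs: "(fls_regpart f * fls_regpart s) $ n \<in> R" for n
    using assms(2) unfolding fls_over_def by (metis fls_regpart_fps_trivial fls_regpart_nth mem_Collect_eq)
  have "fls_regpart s $ n \<in> R" for n
    by (rule fps_quotient_coeff_mem[OF _ fs, of 1]) (use assms(1,4) in \<open>auto simp: fls_over_def\<close>)
  then show ?thesis
    using assms(5) by (intro mem_fls_overI)
qed

lemma fls_sqrt_mem_fls_over:
  assumes "s * s \<in> fls_over R" "\<forall>n<0. s $$ n = 0" "s $$ 0 = 1" "u \<in> R" "u * 2 = 1"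
  shows "s \<in> fls_over R"
proof -
  have "s * s = fps_to_fls (fls_regpart s * fls_regpart s)"
    using assms by (simp add: fls_times_fps_to_fls fps_to_fls_regpart)
  then have ss: "(fls_regpart s * fls_regpart s) $ n \<in> R" for n
    using assms(1) unfolding fls_over_def by (metis fls_regpart_fps_trivial fls_regpart_nth mem_Collect_eq)
  have "fls_regpart s $ n \<in> R" for n
    by (rule fps_sqrt_coeff_mem[OF ss, of u]) (use assms(3-5) in auto)
  then show ?thesis
    using assms(2) by (intro mem_fls_overI)
qed

end

subsection \<open>Series in t with Laurent series in x as coefficients\<close>

text \<open>Used at both levels: on the inner type it concerns exponents of x, on the outer type
  exponents of t.\<close>

definition nonneg_exps :: "'a::comm_ring_1 fls set" where
  "nonneg_exps = {p. \<forall>k<0. p $$ k = 0}"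

definition nonpos_exps :: "'a::comm_ring_1 fls set" where
  "nonpos_exps = {p. \<forall>k>0. p $$ k = 0}"

definition laurent_polys :: "'a::comm_ring_1 fls set" where
  "laurent_polys = {p. finite {k. p $$ k \<noteq> 0}}"

interpretation nonneg: subring_set nonneg_exps
proof
  fix p q :: "'a fls" assume pq: "p \<in> nonneg_exps" "q \<in> nonneg_exps"
  have "(p * q) $$ k = 0" if "k < 0" for k
  proof -
    have "p $$ i * q $$ (k - i) = 0" for i
      using pq that by (cases "i < 0") (auto simp: nonneg_exps_def)
    then show ?thesis
      by (subst fls_times_nth_superset[of "{}"]) auto
  qed
  then show "p * q \<in> nonneg_exps"
    by (auto simp: nonneg_exps_def)
qed (auto simp: nonneg_exps_def)

interpretation nonpos: subring_set nonpos_exps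
proof
  fix p q :: "'a fls" assume pq: "p \<in> nonpos_exps" "q \<in> nonpos_exps"
  have "(p * q) $$ k = 0" if "k > 0" for k
  proof -
    have "p $$ i * q $$ (k - i) = 0" for i
      using pq that by (cases "i > 0") (auto simp: nonpos_exps_def)
    then show ?thesis
      by (subst fls_times_nth_superset[of "{}"]) auto
  qed
  then show "p * q \<in> nonpos_exps"
    by (auto simp: nonpos_exps_def)
qed (auto simp: nonpos_exps_def)

interpretation laurent: subring_set laurent_polys
proof
  fix p q :: "'a fls" assume pq: "p \<in> laurent_polys" "q \<in> laurent_polys"
  define I where "I = {k. p $$ k \<noteq> 0}"
  define J where "J = {k. q $$ k \<noteq> 0}"
  have fin: "finite I" "finite J"
    using pq by (auto simp: I_def J_def laurent_polys_def)
  have "k \<in> (\<lambda>(i, j). i + j) ` (I \<times> J)" if "(p * q) $$ k \<noteq> 0" for k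
  proof -
    have "(p * q) $$ k = (\<Sum>i\<in>I. p $$ i * q $$ (k - i))"
      by (rule fls_times_nth_superset[OF fin(1)]) (auto simp: I_def)
    with that have "(\<Sum>i\<in>I. p $$ i * q $$ (k - i)) \<noteq> 0"
      by simp
    then obtain i where "i \<in> I" "p $$ i * q $$ (k - i) \<noteq> 0"
      by (rule sum.not_neutral_contains_not_neutral)
    then have "(i, k - i) \<in> I \<times> J" "k = i + (k - i)"
      by (auto simp: J_def)
    then show ?thesis by force
  qed
  then have "{k. (p * q) $$ k \<noteq> 0} \<subseteq> (\<lambda>(i, j). i + j) ` (I \<times> J)"
    by auto
  then show "p * q \<in> laurent_polys"
    using fin finite_subset unfolding laurent_polys_def by blast
next
  fix p q :: "'a fls" assume pq: "p \<in> laurent_polys" "q \<in> laurent_polys"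
  have "{k. (p + q) $$ k \<noteq> 0} \<subseteq> {k. p $$ k \<noteq> 0} \<union> {k. q $$ k \<noteq> 0}"
    by auto
  then show "p + q \<in> laurent_polys"
    using pq finite_subset unfolding laurent_polys_def by blast
qed (auto simp: laurent_polys_def)

text \<open>The bound is uniform in the exponent of t. By its type every coefficient has some lowest
  exponent of x, but that exponent may tend to minus infinity as \<open>n\<close> grows.\<close>

definition xge :: "int \<Rightarrow> 'a::comm_ring_1 fls fls set" where
  "xge M = {F. \<forall>n. \<forall>k<M. F $$ n $$ k = 0}"

definition xle :: "int \<Rightarrow> 'a::comm_ring_1 fls fls set" where
  "xle M = {F. \<forall>n. \<forall>k>M. F $$ n $$ k = 0}"

lemma xge_0: "xge 0 = fls_over nonneg_exps"
  by (auto simp: xge_def fls_over_def nonneg_exps_def)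

lemma xle_0: "xle 0 = fls_over nonpos_exps"
  by (auto simp: xle_def fls_over_def nonpos_exps_def)

lemma xge_mono: "F \<in> xge M \<Longrightarrow> N \<le> M \<Longrightarrow> F \<in> xge N"
  by (auto simp: xge_def)

lemma xle_mono: "F \<in> xle M \<Longrightarrow> M \<le> N \<Longrightarrow> F \<in> xle N"
  by (auto simp: xle_def)

lemma xge_add: "F \<in> xge M \<Longrightarrow> G \<in> xge M \<Longrightarrow> F + G \<in> xge M"
  and xge_diff: "F \<in> xge M \<Longrightarrow> G \<in> xge M \<Longrightarrow> F - G \<in> xge M"
  and xle_add: "F \<in> xle M \<Longrightarrow> G \<in> xle M \<Longrightarrow> F + G \<in> xle M"
  by (auto simp: xge_def xle_def)

lemma fls_times_nth_nth:
  fixes F G :: "'a::comm_ring_1 fls fls"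
  assumes "finite I" "\<And>a b i. i \<notin> I \<Longrightarrow> F $$ a $$ i * G $$ b $$ (k - i) = 0"
  shows "(F * G) $$ n $$ k =
    (\<Sum>i\<in>I. \<Sum>a = fls_subdegree F..n - fls_subdegree G. F $$ a $$ i * G $$ (n - a) $$ (k - i))"
proof -
  have "(F * G) $$ n $$ k = (\<Sum>a = fls_subdegree F..n - fls_subdegree G. (F $$ a * G $$ (n - a)) $$ k)"
    by (simp add: fls_times_nth(2) fls_nth_sum)
  also have "\<dots> = (\<Sum>a = fls_subdegree F..n - fls_subdegree G. \<Sum>i\<in>I. F $$ a $$ i * G $$ (n - a) $$ (k - i))"
    using assms by (intro sum.cong refl fls_times_nth_superset) auto
  finally show ?thesis
    by (subst sum.swap) simp
qed

lemma xge_mult: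
  assumes "F \<in> xge M" "G \<in> xge N"
  shows "F * G \<in> xge (M + N)"
proof -
  have "(F * G) $$ n $$ k = 0" if "k < M + N" for n k
  proof -
    have "F $$ a $$ i * G $$ b $$ (k - i) = 0" for a b i
      using assms that by (cases "i < M") (auto simp: xge_def)
    then show ?thesis
      by (subst fls_times_nth_nth[of "{}"]) auto
  qed
  then show ?thesis by (auto simp: xge_def)
qed

lemma xle_mult:
  assumes "F \<in> xle M" "G \<in> xle N"
  shows "F * G \<in> xle (M + N)"
proof -
  have "(F * G) $$ n $$ k = 0" if "k > M + N" for n k
  proof -
    have "F $$ a $$ i * G $$ b $$ (k - i) = 0" for a b i
      using assms that by (cases "i > M") (auto simp: xle_def)
    then show ?thesis
      by (subst fls_times_nth_nth[of "{}"]) auto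
  qed
  then show ?thesis by (auto simp: xle_def)
qed

lemma xge_power: "F \<in> xge M \<Longrightarrow> F ^ n \<in> xge (int n * M)"
proof (induction n)
  case (Suc n)
  then show ?case
    using xge_mult[of F M "F ^ n" "int n * M"] by (simp add: algebra_simps)
qed (auto simp: xge_def)

lemma xle_power: "F \<in> xle M \<Longrightarrow> F ^ n \<in> xle (int n * M)"
proof (induction n)
  case (Suc n)
  then show ?case
    using xle_mult[of F M "F ^ n" "int n * M"] by (simp add: algebra_simps)
qed (auto simp: xle_def)

lemma xcoeff_nth [simp]: "xcoeff F k $$ n = F $$ n $$ k"
proof -
  have "\<forall>n<fls_subdegree F. F $$ n $$ k = 0" by simp
  then show ?thesis
    unfolding xcoeff_def by (intro nth_Abs_fls_ex_lower_bound) blast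
qed

lemma xcoeff_add: "xcoeff (F + G) k = xcoeff F k + xcoeff G k"
  and xcoeff_diff: "xcoeff (F - G) k = xcoeff F k - xcoeff G k"
  and xcoeff_uminus: "xcoeff (- F) k = - xcoeff F k"
  and xcoeff_0 [simp]: "xcoeff 0 k = 0"
  by (auto intro!: fls_eqI)

lemma xcoeff_1: "xcoeff 1 k = (if k = 0 then 1 else 0)"
  by (auto intro!: fls_eqI)

lemma xcoeff_sum: "xcoeff (sum f I) k = (\<Sum>i\<in>I. xcoeff (f i) k)"
  by (auto intro!: fls_eqI simp: fls_nth_sum)

lemma xcoeff_eqI: "(\<And>k. xcoeff F k = xcoeff G k) \<Longrightarrow> F = G"
  by (metis fls_eq_iff xcoeff_nth)

lemma xge_iff: "F \<in> xge M \<longleftrightarrow> (\<forall>k<M. xcoeff F k = 0)"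
  by (auto simp: xge_def fls_eq_iff)

lemma xle_iff: "F \<in> xle M \<longleftrightarrow> (\<forall>k>M. xcoeff F k = 0)"
  by (auto simp: xle_def fls_eq_iff)

text \<open>The finite set \<open>I\<close> is essential: for general factors infinitely many pairs
  of exponents of x contribute, and the coefficient is only a t-adic limit of such sums.\<close>

lemma xcoeff_mult:
  assumes "finite I" "\<And>i. i \<notin> I \<Longrightarrow> xcoeff F i = 0 \<or> xcoeff G (k - i) = 0"
  shows "xcoeff (F * G) k = (\<Sum>i\<in>I. xcoeff F i * xcoeff G (k - i))"
proof (rule fls_eqI)
  fix n
  have vanish: "F $$ a $$ i * G $$ b $$ (k - i) = 0" if "i \<notin> I" for a b i
    using assms(2)[OF that] by (auto simp: fls_eq_iff)
  have "(\<Sum>i\<in>I. xcoeff F i * xcoeff G (k - i)) $$ n = (\<Sum>i\<in>I. (xcoeff F i * xcoeff G (k - i)) $$ n)"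
    by (simp add: fls_nth_sum)
  also have "\<dots> = (\<Sum>i\<in>I. \<Sum>a = fls_subdegree F..n - fls_subdegree G. F $$ a $$ i * G $$ (n - a) $$ (k - i))"
  proof (intro sum.cong refl)
    fix i
    have "a \<in> {fls_subdegree F..n - fls_subdegree G}"
      if "xcoeff F i $$ a * xcoeff G (k - i) $$ (n - a) \<noteq> 0" for a
    proof (rule ccontr)
      assume "a \<notin> {fls_subdegree F..n - fls_subdegree G}"
      then have "F $$ a = 0 \<or> G $$ (n - a) = 0" by auto
      with that show False by auto
    qed
    then show "(xcoeff F i * xcoeff G (k - i)) $$ n =
        (\<Sum>a = fls_subdegree F..n - fls_subdegree G. F $$ a $$ i * G $$ (n - a) $$ (k - i))"
      by (subst fls_times_nth_superset[of "{fls_subdegree F..n - fls_subdegree G}"]) auto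
  qed
  also have "\<dots> = (F * G) $$ n $$ k"
    using assms(1) vanish by (subst fls_times_nth_nth[of I]) auto
  finally show "xcoeff (F * G) k $$ n = (\<Sum>i\<in>I. xcoeff F i * xcoeff G (k - i)) $$ n"
    by simp
qed

lemma tembed_nth [simp]: "tembed e $$ n = fls_const (e $$ n)"
proof -
  have "\<forall>n<fls_subdegree e. fls_const (e $$ n) = 0" by simp
  then show ?thesis
    unfolding tembed_def by (intro nth_Abs_fls_ex_lower_bound) blast
qed

lemma xcoeff_tembed: "xcoeff (tembed e) k = (if k = 0 then e else 0)"
  by (auto intro!: fls_eqI)

lemma xcoeff_tembed_mult: "xcoeff (tembed e * F) k = e * xcoeff F k"
  by (subst xcoeff_mult[of "{0}"]) (auto simp: xcoeff_tembed)

lemma tembed_0 [simp]: "tembed 0 = 0" and tembed_1 [simp]: "tembed 1 = 1"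
  and tembed_add: "tembed (a + b) = tembed a + tembed b"
  and tembed_uminus: "tembed (- a) = - tembed a"
  and tembed_mult: "tembed (a * b) = tembed a * tembed b"
  by (rule xcoeff_eqI; simp add: xcoeff_tembed xcoeff_add xcoeff_uminus xcoeff_diff xcoeff_tembed_mult xcoeff_1)+

lemma tembed_X: "tembed fls_X = tvar"
  by (rule fls_eqI) auto

lemma xcoeff_xpow: "xcoeff (xpow m) k = (if k = m then 1 else 0)"
  by (rule fls_eqI) (auto simp: xpow_def)

lemma xcoeff_xpow_mult: "xcoeff (xpow m * F) k = xcoeff F (k - m)"
  by (subst xcoeff_mult[of "{m}"]) (auto simp: xcoeff_xpow)

lemma xpow_mult: "xpow a * xpow b = xpow (a + b)"
  by (simp add: xpow_def fls_X_intpow_times_fls_X_intpow)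

lemma xpow_0 [simp]: "xpow 0 = 1"
  by (simp add: xpow_def)

lemma xpow_power: "xpow a ^ n = xpow (int n * a)"
  by (induction n) (auto simp: xpow_mult algebra_simps)

lemma xpow_nz [simp]: "xpow a \<noteq> 0"
  using xpow_mult[of a "- a"] by auto

lemma xpow_xge [intro]: "xpow k \<in> xge k" and xpow_xle [intro]: "xpow k \<in> xle k"
  by (auto simp: xge_iff xle_iff xcoeff_xpow)

lemma tembed_xge [intro]: "tembed e \<in> xge 0" and tembed_xle [intro]: "tembed e \<in> xle 0"
  by (auto simp: xge_iff xle_iff xcoeff_tembed)

lemma laurent_expansion:
  assumes "F \<in> xge a" "F \<in> xle b"
  shows "F = (\<Sum>k = a..b. tembed (xcoeff F k) * xpow k)"
proof (rule xcoeff_eqI)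
  fix m
  have "xcoeff (\<Sum>k = a..b. tembed (xcoeff F k) * xpow k) m
      = (\<Sum>k = a..b. if m = k then xcoeff F k else 0)"
    by (simp add: xcoeff_sum xcoeff_tembed_mult xcoeff_xpow if_distrib cong: if_cong)
  also have "\<dots> = (if m \<in> {a..b} then xcoeff F m else 0)"
    by simp
  also have "\<dots> = xcoeff F m"
    using assms by (auto simp: xge_iff xle_iff)
  finally show "xcoeff F m = xcoeff (\<Sum>k = a..b. tembed (xcoeff F k) * xpow k) m" ..
qed

text \<open>The one-sided bound makes every convolution finite, and so makes the set of series with
  all x-coefficients in \<open>K\<close> a ring.\<close>

definition xcoeffs_ge :: "complex fls set \<Rightarrow> complex fls fls set" where
  "xcoeffs_ge K = {F. (\<exists>M. F \<in> xge M) \<and> (\<forall>k. xcoeff F k \<in> K)}"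

definition xcoeffs_le :: "complex fls set \<Rightarrow> complex fls fls set" where
  "xcoeffs_le K = {F. (\<exists>M. F \<in> xle M) \<and> (\<forall>k. xcoeff F k \<in> K)}"

lemma subring_set_xcoeffs_ge:
  assumes "subring_set K"
  shows "subring_set (xcoeffs_ge K)"
proof -
  interpret subring_set K by fact
  show ?thesis
  proof
    fix F G assume "F \<in> xcoeffs_ge K" "G \<in> xcoeffs_ge K"
    then obtain M N where FG: "F \<in> xge M" "G \<in> xge N" "\<And>k. xcoeff F k \<in> K" "\<And>k. xcoeff G k \<in> K"
      by (auto simp: xcoeffs_ge_def)
    have "F + G \<in> xge (min M N)"
      using FG by (intro xge_add) (auto intro: xge_mono)
    then show "F + G \<in> xcoeffs_ge K"
      using FG by (auto simp: xcoeffs_ge_def xcoeff_add)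
    have "xcoeff (F * G) k = (\<Sum>i = M..k - N. xcoeff F i * xcoeff G (k - i))" for k
      using FG(1,2) by (intro xcoeff_mult) (auto simp: xge_iff)
    then have "xcoeff (F * G) k \<in> K" for k
      using FG(3,4) by (simp add: sum_mem mult_mem)
    then show "F * G \<in> xcoeffs_ge K"
      using xge_mult[OF FG(1,2)] unfolding xcoeffs_ge_def by blast
  qed (auto simp: xcoeffs_ge_def xcoeff_1 xcoeff_uminus xge_iff)
qed

lemma subring_set_xcoeffs_le:
  assumes "subring_set K"
  shows "subring_set (xcoeffs_le K)"
proof -
  interpret subring_set K by fact
  show ?thesis
  proof
    fix F G assume "F \<in> xcoeffs_le K" "G \<in> xcoeffs_le K"
    then obtain M N where FG: "F \<in> xle M" "G \<in> xle N" "\<And>k. xcoeff F k \<in> K" "\<And>k. xcoeff G k \<in> K"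
      by (auto simp: xcoeffs_le_def)
    have "F + G \<in> xle (max M N)"
      using FG by (intro xle_add) (auto intro: xle_mono)
    then show "F + G \<in> xcoeffs_le K"
      using FG by (auto simp: xcoeffs_le_def xcoeff_add)
    have "xcoeff (F * G) k = (\<Sum>i = k - N..M. xcoeff F i * xcoeff G (k - i))" for k
      using FG(1,2) by (intro xcoeff_mult) (auto simp: xle_iff)
    then have "xcoeff (F * G) k \<in> K" for k
      using FG(3,4) by (simp add: sum_mem mult_mem)
    then show "F * G \<in> xcoeffs_le K"
      using xle_mult[OF FG(1,2)] unfolding xcoeffs_le_def by blast
  qed (auto simp: xcoeffs_le_def xcoeff_1 xcoeff_uminus xle_iff)
qed

subsection \<open>Counting walks\<close>

lemma wpos_append_le: "m \<le> length ws \<Longrightarrow> wpos (ws @ [s]) m = wpos ws m"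
  by (simp add: wpos_def)

lemma wpos_append_Suc:
  "wpos (ws @ [s]) (Suc (length ws)) = (fst (wpos ws (length ws)) + fst s, snd (wpos ws (length ws)) + snd s)"
  by (simp add: wpos_def)

lemma finite_slit_walks: "finite A \<Longrightarrow> finite (slit_walks A n)"
  by (rule finite_subset[OF _ finite_lists_length_eq[of A n]]) (auto simp: slit_walks_def)

lemma slit_walks_append_iff:
  assumes "length ws = n"
  shows "ws @ [s] \<in> slit_walks A (Suc n) \<longleftrightarrow>
    ws \<in> slit_walks A n \<and> s \<in> A \<and> wpos (ws @ [s]) (Suc n) \<notin> slit"
proof -
  have "{1..Suc n} = insert (Suc n) {1..n}" by auto
  then show ?thesis
    using assms by (auto simp: slit_walks_def wpos_append_le)
qed

lemma acount_0: "acount A i j 0 = (if i = 0 \<and> j = 0 then 1 else 0)"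
proof -
  have "{ws \<in> slit_walks A 0. wpos ws 0 = (i, j)} = (if i = 0 \<and> j = 0 then {[]} else {})"
    by (auto simp: slit_walks_def wpos_def)
  then show ?thesis by (simp add: acount_def)
qed

lemma acount_slit: "(i, j) \<in> slit \<Longrightarrow> acount A i j (Suc n) = 0"
proof -
  assume "(i, j) \<in> slit"
  then have "{ws \<in> slit_walks A (Suc n). wpos ws (Suc n) = (i, j)} = {}"
    by (auto simp: slit_walks_def dest!: bspec[of _ _ "Suc n"])
  then show ?thesis by (simp only: acount_def card.empty)
qed

text \<open>Removal of the last step. An endpoint off the slit imposes nothing further on the
  shorter walk, so every combination of a walk and a step is realised.\<close>

lemma acount_Suc:
  assumes "finite A" "(i, j) \<notin> slit"
  shows "acount A i j (Suc n) = (\<Sum>s\<in>A. acount A (i - fst s) (j - snd s) n)"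
proof -
  define B where "B s = {ws \<in> slit_walks A n. wpos ws n = (i - fst s, j - snd s)}" for s
  have "bij_betw (\<lambda>(s, ws). ws @ [s]) (SIGMA s:A. B s)
      {ws \<in> slit_walks A (Suc n). wpos ws (Suc n) = (i, j)}"
  proof (rule bij_betwI[where g = "\<lambda>ws. (last ws, butlast ws)"])
    show "(\<lambda>(s, ws). ws @ [s]) \<in> (SIGMA s:A. B s) \<rightarrow> {ws \<in> slit_walks A (Suc n). wpos ws (Suc n) = (i, j)}"
    proof safe
      fix a b ws assume s: "(a, b) \<in> A" and "ws \<in> B (a, b)"
      then have ws: "ws \<in> slit_walks A n" "wpos ws n = (i - a, j - b)" "length ws = n"
        by (auto simp: B_def slit_walks_def)
      then show "wpos (ws @ [(a, b)]) (Suc n) = (i, j)"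
        using wpos_append_Suc[of ws "(a, b)"] by simp
      then show "ws @ [(a, b)] \<in> slit_walks A (Suc n)"
        using ws s assms(2) by (simp add: slit_walks_append_iff)
    qed
    show "(\<lambda>ws. (last ws, butlast ws)) \<in> {ws \<in> slit_walks A (Suc n). wpos ws (Suc n) = (i, j)} \<rightarrow> (SIGMA s:A. B s)"
    proof
      fix ws assume ws: "ws \<in> {ws \<in> slit_walks A (Suc n). wpos ws (Suc n) = (i, j)}"
      then have "length ws = Suc n" by (auto simp: slit_walks_def)
      then obtain vs s where eq: "ws = vs @ [s]" "length vs = n"
        by (metis length_Suc_conv_rev)
      have "vs \<in> slit_walks A n" "s \<in> A"
        using ws eq slit_walks_append_iff[of vs n s A] by auto
      then show "(last ws, butlast ws) \<in> (SIGMA s:A. B s)"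
        using ws eq wpos_append_Suc[of vs s] by (auto simp: B_def prod_eq_iff)
    qed
  qed (auto simp: slit_walks_def intro!: append_butlast_last_id)
  then have "acount A i j (Suc n) = card (SIGMA s:A. B s)"
    unfolding acount_def by (rule bij_betw_same_card[symmetric])
  also have "\<dots> = (\<Sum>s\<in>A. card (B s))"
    using assms(1) finite_slit_walks[OF assms(1)] by (simp add: B_def)
  finally show ?thesis
    by (simp add: B_def acount_def)
qed

text \<open>Needed because \<open>Sminus\<close> is built with \<open>Abs_fls\<close>, which is
  faithful only when finitely many negative exponents occur.\<close>

lemma finite_acount_support:
  assumes "finite A"
  shows "finite {i. acount A i j n \<noteq> 0}"
proof (rule finite_subset)
  show "{i. acount A i j n \<noteq> 0} \<subseteq> (\<lambda>ws. fst (wpos ws n)) ` slit_walks A n"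
  proof safe
    fix i assume "acount A i j n > 0"
    then obtain ws where "ws \<in> slit_walks A n" "wpos ws n = (i, j)"
      unfolding acount_def by (metis (mono_tags, lifting) card_gt_0_iff ex_in_conv mem_Collect_eq)
    then show "i \<in> (\<lambda>ws. fst (wpos ws n)) ` slit_walks A n"
      by (intro image_eqI[of _ _ ws]) auto
  qed
qed (use finite_slit_walks[OF assms] in simp)

lemma Splus_nth:
  "Splus A j $$ n $$ i = (if n \<ge> 0 \<and> i \<ge> 0 then of_nat (acount A i j (nat n)) else 0)"
  by (simp add: Splus_def)

lemma Sminus_nth:
  assumes "finite A"
  shows "Sminus A j $$ n $$ i = (if n \<ge> 0 \<and> i < 0 then of_nat (acount A i j (nat n)) else 0)"
proof -
  have "Abs_fls (\<lambda>i. if i < 0 then of_nat (acount A i j m) else 0) $$ i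
      = (if i < 0 then of_nat (acount A i j m) else (0::complex))" for m i
  proof (rule nth_Abs_fls_finite_nonzero_neg_nth)
    show "finite {n. (if - int n < 0 then of_nat (acount A (- int n) j m) else 0) \<noteq> (0::complex)}"
    proof (rule finite_subset)
      show "{n. (if - int n < 0 then of_nat (acount A (- int n) j m) else 0) \<noteq> (0::complex)}
        \<subseteq> (\<lambda>n. - int n) -` {i. acount A i j m \<noteq> 0}"
        by auto
      show "finite ((\<lambda>n. - int n) -` {i. acount A i j m \<noteq> 0})"
        by (intro finite_vimageI finite_acount_support assms) (simp add: inj_on_def)
    qed
  qed
  then show ?thesis by (simp add: Sminus_def)
qed

text \<open>The series $S_j$ of the overview, abbreviated to \<open>W\<close> below.\<close>

definition slit_series :: "(int \<times> int) set \<Rightarrow> int \<Rightarrow> complex fls fls" where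
  "slit_series A j = Splus A j + Sminus A j"

lemma slit_series_nth:
  "finite A \<Longrightarrow> slit_series A j $$ n $$ i = (if n \<ge> 0 then of_nat (acount A i j (nat n)) else 0)"
  by (simp add: slit_series_def Splus_nth Sminus_nth)

lemma xcoeff_slit_series: "finite A \<Longrightarrow> xcoeff (slit_series A j) i = Sij A i j"
  by (rule fls_eqI) (simp add: Sij_def slit_series_nth)

lemma xcoeff_Splus: "xcoeff (Splus A j) i = (if i \<ge> 0 then Sij A i j else 0)"
  by (rule fls_eqI) (simp add: Sij_def Splus_nth)

lemma xcoeff_Sminus: "finite A \<Longrightarrow> xcoeff (Sminus A j) i = (if i < 0 then Sij A i j else 0)"
  by (rule fls_eqI) (simp add: Sij_def Sminus_nth)

lemma xcoeff_Apoly_mult: "xcoeff (Apoly A h * F) i = (\<Sum>p\<in>{p. (p, h) \<in> A}. xcoeff F (i - p))"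
  by (simp add: Apoly_def sum_distrib_right xcoeff_sum xcoeff_xpow_mult)

section \<open>Functional equations for symmetric steps of height at most 1\<close>

locale slit_steps =
  fixes A :: "(int \<times> int) set"
  assumes finA: "finite A"
    and symA: "\<And>i j. (i, j) \<in> A \<Longrightarrow> (i, - j) \<in> A"
    and heights: "\<And>i j. (i, j) \<in> A \<Longrightarrow> \<bar>j\<bar> \<le> 1"
begin

abbreviation "W \<equiv> slit_series A"

text \<open>Reflection in the horizontal axis fixes the slit and permutes the steps. It merges the
  heights -1 and 1 in the equation on the axis.\<close>

lemma acount_uminus: "acount A i (- j) n = acount A i j n"
proof (induction n arbitrary: i j)
  case 0
  then show ?case by (simp add: acount_0)
next
  case (Suc n)
  show ?case
  proof (cases "(i, j) \<in> slit")
    case True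
    then have "(i, - j) \<in> slit" by (auto simp: slit_def)
    with True show ?thesis by (simp add: acount_slit)
  next
    case False
    then have neg: "(i, - j) \<notin> slit" by (auto simp: slit_def)
    have bij: "bij_betw (\<lambda>s. (fst s, - snd s)) A A"
      by (rule bij_betwI[where g = "\<lambda>s. (fst s, - snd s)"]) (auto simp: symA)
    have "acount A i (- j) (Suc n) = (\<Sum>s\<in>A. acount A (i - fst s) (- j - snd s) n)"
      by (rule acount_Suc[OF finA neg])
    also have "\<dots> = (\<Sum>s\<in>A. acount A (i - fst s) (- (j - snd s)) n)"
      by (subst sum.reindex_bij_betw[OF bij, symmetric]) (simp add: algebra_simps)
    also have "\<dots> = acount A i j (Suc n)"
      unfolding acount_Suc[OF finA False] Suc ..
    finally show ?thesis .
  qed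
qed

lemma Sij_uminus: "Sij A i (- j) = Sij A i j"
  by (simp add: Sij_def acount_uminus)

lemma slit_series_uminus: "W (- j) = W j"
  by (rule xcoeff_eqI) (simp add: xcoeff_slit_series finA Sij_uminus)

lemma finite_row [simp, intro]: "finite {p. (p, h) \<in> A}"
  using finite_vimageI[OF finA, of "\<lambda>p. (p, h)"] by (simp add: vimage_def inj_on_def)

text \<open>By symmetry the rows at heights 1 and -1 contain the same horizontal displacements, so
  $A_1$ also describes the downward steps.\<close>

lemma sum_steps:
  fixes f :: "int \<Rightarrow> int \<Rightarrow> 'b::comm_monoid_add"
  shows "(\<Sum>s\<in>A. f (fst s) (snd s)) = (\<Sum>p\<in>{p. (p, 0) \<in> A}. f p 0) +
    ((\<Sum>p\<in>{p. (p, 1) \<in> A}. f p 1) + (\<Sum>p\<in>{p. (p, 1) \<in> A}. f p (- 1)))"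
proof -
  have rows: "{p. (p, - 1) \<in> A} = {p. (p, 1) \<in> A}"
    using symA[of _ 1] symA[of _ "- 1"] by auto
  have A_eq: "A = {p. (p, 0) \<in> A} \<times> {0} \<union> ({p. (p, 1) \<in> A} \<times> {1} \<union> {p. (p, - 1) \<in> A} \<times> {- 1})"
    (is "A = ?B")
  proof
    show "A \<subseteq> ?B"
    proof
      fix s assume "s \<in> A"
      moreover obtain i j where "s = (i, j)" by force
      moreover have "j = 0 \<or> j = 1 \<or> j = - 1" if "\<bar>j\<bar> \<le> 1" for j :: int using that by linarith
      ultimately show "s \<in> ?B" using heights[of i j] by auto
    qed
  qed auto
  have row: "(\<Sum>s\<in>{p. (p, h) \<in> A} \<times> {h}. f (fst s) (snd s)) = (\<Sum>p\<in>{p. (p, h) \<in> A}. f p h)" for h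
    by (subst sum.cartesian_product') simp
  have "(\<Sum>s\<in>A. f (fst s) (snd s)) = (\<Sum>s\<in>?B. f (fst s) (snd s))"
    using A_eq by simp
  also have "\<dots> = (\<Sum>s\<in>{p. (p, 0) \<in> A} \<times> {0}. f (fst s) (snd s)) +
     ((\<Sum>s\<in>{p. (p, 1) \<in> A} \<times> {1}. f (fst s) (snd s)) + (\<Sum>s\<in>{p. (p, - 1) \<in> A} \<times> {- 1}. f (fst s) (snd s)))"
    by (subst sum.union_disjoint, simp, simp, force, subst sum.union_disjoint) (simp_all, force)
  finally show ?thesis
    unfolding row unfolding rows .
qed

lemma step_sum_nth:
  assumes "n > 0"
  shows "(tvar * (Apoly A 0 * W j + Apoly A 1 * (W (j - 1) + W (j + 1)))) $$ n $$ i
    = of_nat (\<Sum>s\<in>A. acount A (i - fst s) (j - snd s) (nat n - 1))"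
proof -
  have nn: "nat (n - 1) = nat n - 1" using assms by linarith
  have Ap: "(Apoly A h * F) $$ m $$ i = (\<Sum>p\<in>{p. (p, h) \<in> A}. F $$ m $$ (i - p))" for h F m i
    using arg_cong[OF xcoeff_Apoly_mult[of A h F i], of "\<lambda>e. e $$ m"] by (simp add: fls_nth_sum)
  show ?thesis
    using assms sum_steps[of "\<lambda>p q. acount A (i - p) (j - q) (nat n - 1)"]
    by (simp add: fls_X_times_conv_shift Ap slit_series_nth finA nn sum.distrib)
qed

lemma slit_series_recurrence:
  assumes "j \<noteq> 0"
  shows "W j = tvar * (Apoly A 0 * W j + Apoly A 1 * (W (j - 1) + W (j + 1)))" (is "_ = ?rhs")
proof (intro fls_eqI)
  fix n i
  have ns: "(i, j) \<notin> slit" using assms by (auto simp: slit_def)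
  \<comment> \<open>The factor \<open>tvar\<close> shifts the index, so only coefficients at the
    negative index \<open>n - 1\<close> enter.\<close>
  have zero: "?rhs $$ n $$ i = 0" if "n \<le> 0"
  proof -
    have z: "W j $$ (n - 1) = 0" for j
      by (rule fls_eqI) (use that in \<open>simp add: slit_series_nth finA\<close>)
    show ?thesis
      using that z by (simp add: fls_X_times_conv_shift Apoly_def xpow_def sum_distrib_right fls_nth_sum)
  qed
  show "W j $$ n $$ i = ?rhs $$ n $$ i"
  proof (cases "n > 0")
    case True
    then have "nat n = Suc (nat n - 1)" by simp
    then have "acount A i j (nat n) = (\<Sum>s\<in>A. acount A (i - fst s) (j - snd s) (nat n - 1))"
      by (metis acount_Suc[OF finA ns])
    then show ?thesis
      using step_sum_nth[OF True] True by (simp add: slit_series_nth finA)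
  next
    case False
    then show ?thesis
      using zero assms by (simp add: slit_series_nth finA acount_0)
  qed
qed

text \<open>At height 0 the one-step equation fails only through the empty walk and through the
  steps that would land on the slit; both concern abscissae at most 0.\<close>

lemma slit_series_boundary:
  "W 0 - tvar * (Apoly A 0 * W 0 + Apoly A 1 * (W (- 1) + W 1)) \<in> xle 0" (is "W 0 - ?rhs \<in> _")
  unfolding xle_def
proof safe
  fix n k :: int assume k: "k > 0"
  have ns: "(k, 0) \<notin> slit" using k by (auto simp: slit_def)
  have zero: "?rhs $$ n $$ k = 0" if "n \<le> 0"
  proof -
    have z: "W j $$ (n - 1) = 0" for j
      by (rule fls_eqI) (use that in \<open>simp add: slit_series_nth finA\<close>)
    show ?thesis
      using that z by (simp add: fls_X_times_conv_shift Apoly_def xpow_def sum_distrib_right fls_nth_sum)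
  qed
  have "W 0 $$ n $$ k = ?rhs $$ n $$ k"
  proof (cases "n > 0")
    case True
    then have "nat n = Suc (nat n - 1)" by simp
    then have "acount A k 0 (nat n) = (\<Sum>s\<in>A. acount A (k - fst s) (0 - snd s) (nat n - 1))"
      by (metis acount_Suc[OF finA ns])
    then show ?thesis
      using step_sum_nth[OF True, of 0 k] True by (simp add: slit_series_nth finA)
  next
    case False
    then show ?thesis
      using zero k by (simp add: slit_series_nth finA acount_0)
  qed
  then show "(W 0 - ?rhs) $$ n $$ k = 0" by simp
qed

text \<open>A nonempty walk never ends on the slit, so at height 0 the empty walk alone has abscissa
  at most 0.\<close>

lemma slit_series_0_xge: "W 0 \<in> xge 0" and xcoeff_slit_series_0: "xcoeff (W 0) 0 = 1"
proof -
  have *: "acount A i 0 n = (if i = 0 \<and> n = 0 then 1 else 0)" if "i \<le> 0" for i n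
    using that acount_slit[of i 0 A] by (cases n) (auto simp: acount_0 slit_def)
  show "W 0 \<in> xge 0"
    by (auto simp: xge_def slit_series_nth finA *)
  show "xcoeff (W 0) 0 = 1"
    by (rule fls_eqI) (auto simp: slit_series_nth finA *)
qed

end

section \<open>Infinite descent in t and the binomial expansion\<close>

lemma nonneg_times_nth_0:
  "p \<in> nonneg_exps \<Longrightarrow> q \<in> nonneg_exps \<Longrightarrow> (p * q) $$ 0 = p $$ 0 * q $$ 0"
proof -
  assume *: "p \<in> nonneg_exps" "q \<in> nonneg_exps"
  have "p $$ i * q $$ (0 - i) = 0" if "i \<noteq> 0" for i
    using * that by (cases "i < 0") (auto simp: nonneg_exps_def)
  then show ?thesis
    by (subst fls_times_nth_superset[of "{0}"]) auto
qed

lemma nonneg_exps_subdegree: "f \<in> nonneg_exps \<Longrightarrow> fls_subdegree f \<ge> 0"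
  by (cases "f = 0") (auto simp: nonneg_exps_def intro: fls_subdegree_geI)

text \<open>As \<open>v\<close> has order 0 and \<open>c\<close> order at least 1, a nonzero
  \<open>e j\<close> forces a nonzero \<open>e (Suc j)\<close> of strictly smaller order, which
  cannot continue among nonnegative orders.\<close>

lemma t_adic_vanishing:
  fixes e :: "nat \<Rightarrow> 'a::field fls"
  assumes e: "\<And>j. e j \<in> nonneg_exps" and rec: "\<And>j. v * e j = c * e (Suc j)"
    and v: "v \<in> nonneg_exps" "v $$ 0 \<noteq> 0" and c: "c \<in> nonneg_exps" "c $$ 0 = 0"
  shows "e j = 0"
proof (rule ccontr)
  have v0: "fls_subdegree v = 0" "v \<noteq> 0"
    using v by (auto simp: nonneg_exps_def intro!: fls_subdegree_eqI)
  have step: "e (Suc j) \<noteq> 0 \<and> fls_subdegree (e j) \<ge> 1 + fls_subdegree (e (Suc j))" if "e j \<noteq> 0" for j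
  proof -
    have ne: "c * e (Suc j) \<noteq> 0" using rec[of j] that v0 by auto
    have "fls_subdegree c \<ge> 1"
    proof (rule fls_subdegree_geI)
      show "c \<noteq> 0" using ne by auto
      show "c $$ k = 0" if "k < 1" for k
        using that c by (cases "k = 0") (auto simp: nonneg_exps_def)
    qed
    moreover have "fls_subdegree (e j) = fls_subdegree c + fls_subdegree (e (Suc j))"
      using arg_cong[OF rec[of j], of fls_subdegree] ne that v0 by simp
    ultimately show ?thesis using ne by auto
  qed
  assume "e j \<noteq> 0"
  then have "e (j + N) \<noteq> 0 \<and> fls_subdegree (e (j + N)) \<le> fls_subdegree (e j) - int N" for N
    by (induction N) (use step in fastforce)+
  from this[of "nat (fls_subdegree (e j)) + 1"] show False
    using nonneg_exps_subdegree[OF e, of "j + (nat (fls_subdegree (e j)) + 1)"]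
      nonneg_exps_subdegree[OF e, of j] by simp
qed

text \<open>The ranges are those of \<open>fplus\<close> and \<open>fminus\<close>. The case
  \<open>j = 0\<close> is separate because truncated subtraction would leave the spurious odd term
  \<open>f 1\<close>.\<close>

lemma sum_even_odd:
  fixes f :: "nat \<Rightarrow> 'a::comm_monoid_add"
  shows "sum f {..j} = (\<Sum>k = 0..j div 2. f (2 * k)) + (if j = 0 then 0 else \<Sum>k = 0..(j - 1) div 2. f (2 * k + 1))"
proof -
  let ?O = "if j = 0 then {} else {0..(j - 1) div 2}"
  have "{..j} = (\<lambda>k. 2 * k) ` {0..j div 2} \<union> (\<lambda>k. 2 * k + 1) ` ?O" (is "_ = ?E \<union> ?F")
  proof (intro Set.set_eqI iffI)
    fix i assume i: "i \<in> {..j}"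
    show "i \<in> ?E \<union> ?F"
    proof (cases "even i")
      case True
      then have "i = 2 * (i div 2)" "i div 2 \<in> {0..j div 2}" using i by (auto intro: div_le_mono)
      then show ?thesis by blast
    next
      case False
      then have "i = 2 * ((i - 1) div 2) + 1" "j \<noteq> 0" "(i - 1) div 2 \<in> {0..(j - 1) div 2}"
        using i by (auto intro!: div_le_mono elim!: oddE)
      then have "i \<in> ?F" by (intro image_eqI[of _ _ "(i - 1) div 2"]) auto
      then show ?thesis by blast
    qed
  qed (auto split: if_splits)
  moreover have "sum f (?E \<union> ?F) = sum f ?E + sum f ?F"
  proof (rule sum.union_disjoint)
    show "?E \<inter> ?F = {}"
      by (auto split: if_splits) presburger+
  qed auto
  ultimately show ?thesis
    by (auto simp: sum.reindex inj_on_def)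
qed

lemma diff_power_eq_fplus_fminus:
  assumes "r * r = deltaA A"
  shows "(1 - tvar * Apoly A 0 - r) ^ j = fplus A j - r * fminus A j"
proof -
  let ?u = "1 - tvar * Apoly A 0"
  have ev: "(- r) ^ (2 * k) = deltaA A ^ k" for k
    by (simp add: power_mult power2_eq_square assms)
  have od: "(- r) ^ (2 * k + 1) = - r * deltaA A ^ k" for k
    using ev[of k] by simp
  have "(?u - r) ^ j = (- r + ?u) ^ j" by simp
  also have "\<dots> = (\<Sum>k\<le>j. of_nat (j choose k) * (- r) ^ k * ?u ^ (j - k))"
    by (rule binomial_ring)
  also have "\<dots> = fplus A j - r * fminus A j"
    unfolding sum_even_odd fplus_def fminus_def ev od
    by (auto simp: sum_distrib_left sum_negf[symmetric] mult_ac simp del: sum_negf intro!: sum.cong)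
  finally show ?thesis .
qed

lemma is_subfield_gen_field: "is_subfield (gen_field S)"
  unfolding gen_field_def is_subfield_def by blast

lemma gen_field_incl: "S \<subseteq> gen_field S"
  unfolding gen_field_def by blast

lemma gen_field_least: "is_subfield K \<Longrightarrow> S \<subseteq> K \<Longrightarrow> gen_field S \<subseteq> K"
  unfolding gen_field_def by blast

lemma fls_X_mem_ratfuns: "fls_X \<in> ratfuns"
proof -
  have "fls_X = fps_to_fls (fps_of_poly (map_poly of_rat [:0, 1:])) / fps_to_fls (fps_of_poly (map_poly of_rat 1 :: complex poly))"
    by (simp add: map_poly_pCons fps_of_poly_pCons)
  then show ?thesis unfolding ratfuns_def by (metis (mono_tags, lifting) mem_Collect_eq one_neq_zero)
qed

section \<open>One-sided series as power series in x or 1/x\<close>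

definition xside :: "int \<Rightarrow> complex fls fls set" where
  "xside s = {F. \<forall>i. s * i < 0 \<longrightarrow> xcoeff F i = 0}"

lemma xge_0_xside: "xge 0 = xside 1" and xle_0_xside: "xle 0 = xside (- 1)"
  by (auto simp: xge_iff xle_iff xside_def)

text \<open>Exchanges the roles of the variables: a power series in $x^s$ with coefficients in the
  field of series in t. The sign \<open>s\<close> covers both directions at once.\<close>

definition xfps :: "int \<Rightarrow> complex fls fls \<Rightarrow> complex fls fps" where
  "xfps s F = Abs_fps (\<lambda>k. xcoeff F (s * int k))"

lemma xfps_mult:
  assumes s: "s * s = 1" and FG: "F \<in> xside s" "G \<in> xside s"
  shows "xfps s (F * G) = xfps s F * xfps s G"
proof (rule fps_ext)
  fix k
  have ss: "s * (s * a) = a" for a using s by (metis mult.assoc mult_1)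
  have inj: "inj_on (\<lambda>i. s * int i) {0..k}"
    using s by (auto simp: inj_on_def)
  have "xcoeff (F * G) (s * int k) = (\<Sum>i\<in>(\<lambda>i. s * int i) ` {0..k}. xcoeff F i * xcoeff G (s * int k - i))"
  proof (rule xcoeff_mult)
    fix i assume i: "i \<notin> (\<lambda>i. s * int i) ` {0..k}"
    show "xcoeff F i = 0 \<or> xcoeff G (s * int k - i) = 0"
    proof (cases "s * i < 0")
      case True
      then show ?thesis using FG by (simp add: xside_def)
    next
      case False
      then have "i = s * int (nat (s * i))" by (simp add: ss)
      with i have "nat (s * i) > k" by (metis atLeastAtMost_iff image_eqI le0 not_less)
      then have "s * (s * int k - i) < 0" by (simp add: algebra_simps ss)
      then show ?thesis using FG by (simp add: xside_def)
    qed
  qed simp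
  also have "\<dots> = (\<Sum>i = 0..k. xcoeff F (s * int i) * xcoeff G (s * int (k - i)))"
    by (subst sum.reindex[OF inj]) (auto intro!: sum.cong simp: algebra_simps of_nat_diff)
  finally show "xfps s (F * G) $ k = (xfps s F * xfps s G) $ k"
    by (simp add: xfps_def fps_mult_nth)
qed

lemma xcoeff_mem_of_xfps:
  assumes s: "s * s = 1" and F: "F \<in> xside s" and K: "\<And>n. xfps s F $ n \<in> K" "0 \<in> K"
  shows "xcoeff F k \<in> K"
proof (cases "s * k < 0")
  case True
  then show ?thesis using F K by (simp add: xside_def)
next
  case False
  have "s * (s * k) = k" using s by (metis mult.assoc mult_1)
  moreover have "xfps s F $ nat (s * k) = xcoeff F (s * (s * k))"
    using False by (simp add: xfps_def)
  ultimately have "xcoeff F k = xfps s F $ nat (s * k)"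
    by argo
  then show ?thesis using K by simp
qed

lemma xside_sqrt_coeff_mem:
  assumes K: "is_subfield K" and s: "s * s = 1" and F: "F \<in> xside s"
    and FF: "\<And>k. xcoeff (F * F) k \<in> K" and F0: "xcoeff F 0 \<in> K" "xcoeff F 0 \<noteq> 0"
  shows "xcoeff F k \<in> K"
proof -
  interpret subring_set K by (rule subring_set_of_subfield[OF K])
  have "inverse (2 * xcoeff F 0) \<in> K"
    using F0 by (intro is_subfieldD(6)[OF K]) auto
  moreover have "(xfps s F * xfps s F) $ n \<in> K" for n
    unfolding xfps_mult[OF s F F, symmetric] using FF by (simp add: xfps_def)
  ultimately have "xfps s F $ n \<in> K" for n
    using F0 by - (rule fps_sqrt_coeff_mem[of _ "inverse (2 * xcoeff F 0)"], simp_all add: xfps_def)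
  then show ?thesis
    by (intro xcoeff_mem_of_xfps[OF s F]) auto
qed

lemma xside_quotient_coeff_mem:
  assumes K: "is_subfield K" and s: "s * s = 1" and FG: "F \<in> xside s" "G \<in> xside s"
    and mem: "\<And>k. xcoeff F k \<in> K" "\<And>k. xcoeff (F * G) k \<in> K" and F0: "xcoeff F 0 \<noteq> 0"
  shows "xcoeff G k \<in> K"
proof -
  interpret subring_set K by (rule subring_set_of_subfield[OF K])
  have "inverse (xcoeff F 0) \<in> K"
    using mem by (intro is_subfieldD(6)[OF K]) auto
  moreover have "(xfps s F * xfps s G) $ n \<in> K" for n
    unfolding xfps_mult[OF s FG, symmetric] using mem by (simp add: xfps_def)
  ultimately have "xfps s G $ n \<in> K" for n
    using mem F0 by - (rule fps_quotient_coeff_mem[of "xfps s F" _ "inverse (xcoeff F 0)"], simp_all add: xfps_def)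
  then show ?thesis
    by (intro xcoeff_mem_of_xfps[OF s FG(2)]) auto
qed

subsection \<open>The kernel equation\<close>

text \<open>All these series are polynomials in t and powers of x with integer coefficients. The
  subring is left open because the one-sided rings over several fields and the ring
  \<open>poly_mod\<close> are all needed.\<close>

lemma step_polys_mem:
  assumes S: "subring_set S" and t: "tvar \<in> S" and x: "\<And>k. xpow k \<in> S"
  shows "Apoly A h \<in> S" "deltaA A \<in> S" "fplus A j \<in> S" "fminus A j \<in> S"
proof -
  interpret subring_set S by (rule S)
  show A: "Apoly A h \<in> S" for h
    unfolding Apoly_def using x by auto
  have u: "1 - tvar * Apoly A 0 \<in> S"
    using t A by auto
  have "2 * tvar * Apoly A 1 \<in> S"
    using t A by (intro mult_mem) auto
  with u show d: "deltaA A \<in> S"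
    unfolding deltaA_def by auto
  show "fplus A j \<in> S" "fminus A j \<in> S"
    unfolding fplus_def fminus_def using u d by (auto intro!: sum_mem mult_mem power_mem)
qed

lemma xside_xcoeff_mult_0:
  assumes "s * s = 1" "F \<in> xside s" "G \<in> xside s"
  shows "xcoeff (F * G) 0 = xcoeff F 0 * xcoeff G 0"
  using arg_cong[OF xfps_mult[OF assms], of "\<lambda>f. f $ 0"] by (simp add: xfps_def)

lemma tembed_mem_xcoeffs_ge: "0 \<in> K \<Longrightarrow> e \<in> K \<Longrightarrow> tembed e \<in> xcoeffs_ge K"
  and tembed_mem_xcoeffs_le: "0 \<in> K \<Longrightarrow> e \<in> K \<Longrightarrow> tembed e \<in> xcoeffs_le K"
  and xpow_mem_xcoeffs_ge: "0 \<in> K \<Longrightarrow> 1 \<in> K \<Longrightarrow> xpow k \<in> xcoeffs_ge K"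
  and xpow_mem_xcoeffs_le: "0 \<in> K \<Longrightarrow> 1 \<in> K \<Longrightarrow> xpow k \<in> xcoeffs_le K"
  using tembed_xge tembed_xle xpow_xge xpow_xle
  by (auto simp: xcoeffs_ge_def xcoeffs_le_def xcoeff_tembed xcoeff_xpow)

lemma fls_const_half: "fls_const (1 / 2) * 2 = (1 :: complex fls)"
  by (metis fls_const_1 fls_const_mult_const fls_const_numeral nonzero_divide_eq_eq zero_neq_numeral)

locale slit_canonical = slit_steps +
  fixes D Dl Dlb :: "complex fls fls"
  assumes A1_nonzero: "\<exists>i. (i, 1) \<in> A"
    and canon: "canonical_factorization A D Dl Dlb"
begin

abbreviation "c \<equiv> 2 * tvar * Apoly A 1"
abbreviation "u \<equiv> 1 - tvar * Apoly A 0"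
abbreviation "R \<equiv> fsqrt Dl"
abbreviation "Rb \<equiv> fsqrt (D * Dlb)"
abbreviation "K \<equiv> QA A D Dl Dlb"

lemma delta_eq: "deltaA A = D * Dl * Dlb"
  and D_nonneg: "D \<in> nonneg_exps" and D_0: "D $$ 0 = 1"
  and Dl_nonneg: "Dl \<in> nonneg_exps" and Dl_0: "Dl $$ 0 = 1"
  and Dlb_nonneg: "Dlb \<in> nonneg_exps" and Dlb_0: "Dlb $$ 0 = 1"
  and Dl_xge: "Dl \<in> xge 0" and Dlb_xle: "Dlb \<in> xle 0"
  and Dl_laurent: "Dl \<in> fls_over laurent_polys"
  and xcoeff_Dl_0: "xcoeff Dl 0 = 1" and xcoeff_Dlb_0: "xcoeff Dlb 0 = 1"
  using canon unfolding canonical_factorization_def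
  by (auto simp: nonneg_exps_def xge_def xle_def fls_over_def laurent_polys_def intro!: fls_eqI)

lemma D_eq: "D = tembed (xcoeff D 0)"
proof (rule fls_eqI)
  fix n
  obtain d where "D $$ n = fls_const d"
    using canon unfolding canonical_factorization_def by blast
  then show "D $$ n = tembed (xcoeff D 0) $$ n" by simp
qed

lemma DDlb_nonneg: "D * Dlb \<in> nonneg_exps" and DDlb_0: "(D * Dlb) $$ 0 = 1"
  using D_nonneg Dlb_nonneg D_0 Dlb_0 by (auto simp: nonneg_times_nth_0)

lemma R_sq: "R * R = Dl" and R_nonneg: "R \<in> nonneg_exps" and R_0: "R $$ 0 = 1"
  using fsqrt_props[of Dl] Dl_nonneg Dl_0 by (auto simp: nonneg_exps_def)

lemma Rb_sq: "Rb * Rb = D * Dlb" and Rb_nonneg: "Rb \<in> nonneg_exps" and Rb_0: "Rb $$ 0 = 1"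
  using fsqrt_props[of "D * Dlb"] DDlb_nonneg DDlb_0 by (auto simp: nonneg_exps_def)

lemma R_nz [simp]: "R \<noteq> 0"
  using R_0 by auto

lemma R_xge: "R \<in> xge 0"
  unfolding xge_0
proof (rule nonneg.fls_sqrt_mem_fls_over)
  show "R * R \<in> fls_over nonneg_exps" using Dl_xge by (simp add: R_sq xge_0)
  show "fls_const (1 / 2) \<in> nonneg_exps" by (simp add: nonneg_exps_def)
  show "fls_const (1 / 2) * 2 = (1 :: complex fls)" by (rule fls_const_half)
qed (use R_nonneg R_0 in \<open>auto simp: nonneg_exps_def\<close>)

lemma DDlb_xle: "D * Dlb \<in> xle 0"
  using xle_mult[OF tembed_xle[of "xcoeff D 0"] Dlb_xle] by (simp flip: D_eq)

lemma Rb_xle: "Rb \<in> xle 0"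
  unfolding xle_0
proof (rule nonpos.fls_sqrt_mem_fls_over)
  show "Rb * Rb \<in> fls_over nonpos_exps" using DDlb_xle by (simp add: Rb_sq xle_0)
  show "fls_const (1 / 2) \<in> nonpos_exps" by (simp add: nonpos_exps_def)
  show "fls_const (1 / 2) * 2 = (1 :: complex fls)" by (rule fls_const_half)
qed (use Rb_nonneg Rb_0 in \<open>auto simp: nonneg_exps_def\<close>)

lemma RRb_sq: "(R * Rb) * (R * Rb) = deltaA A"
proof -
  have "(R * Rb) * (R * Rb) = (R * R) * (Rb * Rb)" by (simp add: mult_ac)
  then show ?thesis by (simp add: R_sq Rb_sq delta_eq mult_ac)
qed

lemma xcoeff_R_0: "xcoeff R 0 = 1"
proof -
  have "xcoeff (R * R) 0 = xcoeff R 0 * xcoeff R 0"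
    using R_xge by (intro xside_xcoeff_mult_0[of 1]) (auto simp: xge_0_xside)
  then have "(xcoeff R 0 - 1) * (xcoeff R 0 + 1) = 0"
    by (simp add: R_sq xcoeff_Dl_0 algebra_simps)
  moreover have "(xcoeff R 0 + 1) $$ 0 \<noteq> 0" by (simp add: R_0)
  then have "xcoeff R 0 + 1 \<noteq> 0" by (metis fls_zero_nth)
  ultimately show ?thesis by simp
qed

lemma xcoeff_Rb_0: "xcoeff Rb 0 = fsqrt (xcoeff D 0)"
proof (rule fsqrt_eqI[symmetric])
  have "xcoeff (Rb * Rb) 0 = xcoeff Rb 0 * xcoeff Rb 0"
    using Rb_xle by (intro xside_xcoeff_mult_0[of "- 1"]) (auto simp: xle_0_xside)
  moreover have "xcoeff (D * Dlb) 0 = xcoeff D 0"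
    using xcoeff_tembed_mult[of "xcoeff D 0" Dlb 0] D_eq by (simp add: xcoeff_Dlb_0)
  ultimately show "xcoeff Rb 0 * xcoeff Rb 0 = xcoeff D 0" by (simp add: Rb_sq)
qed (use Rb_nonneg Rb_0 in \<open>auto simp: nonneg_exps_def\<close>)

lemma slit_series_nonneg: "W j \<in> nonneg_exps"
  unfolding nonneg_exps_def by (auto intro!: fls_eqI simp: slit_series_nth finA)

lemma Apoly_nth: "n \<noteq> 0 \<Longrightarrow> Apoly A h $$ n = 0"
  by (simp add: Apoly_def xpow_def fls_nth_sum)

lemma Apoly_nonneg: "Apoly A h \<in> nonneg_exps"
  by (simp add: nonneg_exps_def Apoly_nth)

lemma tvar_nonneg: "tvar \<in> nonneg_exps"
  by (simp add: nonneg_exps_def)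

lemma c_nonneg: "c \<in> nonneg_exps" and u_nonneg: "u \<in> nonneg_exps"
  using tvar_nonneg Apoly_nonneg by (auto intro!: nonneg.mult_mem nonneg.diff_mem)

lemma c_0: "c $$ 0 = 0" and u_0: "u $$ 0 = 1"
  by (simp_all add: nonneg_times_nth_0 tvar_nonneg Apoly_nonneg nonneg.mult_mem)

lemma uc_eq: "u * u - c * c = deltaA A"
  by (simp add: deltaA_def algebra_simps)

text \<open>The defect of the geometric relation gains a factor t from each level to the next, so it is
  divisible by every power of t.\<close>
lemma slit_series_Suc: "c * W (int (Suc j)) = (u - R * Rb) * W (int j)"
proof -
  define e where "e j = c * W (int (Suc j)) - (u - R * Rb) * W (int j)" for j
  have "e j = 0" for j
  proof (rule t_adic_vanishing[of e "u + R * Rb" c])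
    show "e j \<in> nonneg_exps" for j
      unfolding e_def using c_nonneg u_nonneg R_nonneg Rb_nonneg slit_series_nonneg
      by (intro nonneg.diff_mem[of "_ * _"] nonneg.mult_mem[of _ "W _"] nonneg.mult_mem[of R]
          nonneg.diff_mem[of u])
    show "u + R * Rb \<in> nonneg_exps"
      using u_nonneg R_nonneg Rb_nonneg by auto
    show "(u + R * Rb) $$ 0 \<noteq> 0"
      using u_0 by (simp add: nonneg_times_nth_0 R_nonneg Rb_nonneg R_0 Rb_0)
    show "c \<in> nonneg_exps" "c $$ 0 = 0" by (fact c_nonneg, fact c_0)
    fix j
    have rec: "W (1 + int j) = tvar * (Apoly A 0 * W (1 + int j) + Apoly A 1 * (W (int j) + W (2 + int j)))"
      using slit_series_recurrence[of "1 + int j"] by (simp add: add.commute)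
    \<comment> \<open>The recurrence is doubled because \<open>c\<close> contains the factor
      2.\<close>
    have "c * W (2 + int j) = 2 * u * W (1 + int j) - c * W (int j)"
      using arg_cong[OF rec, of "\<lambda>F. 2 * F"] by (simp add: algebra_simps)
    moreover have "c * e (Suc j) = c * (c * W (2 + int j)) - (u - R * Rb) * (c * W (1 + int j))"
      by (simp add: e_def algebra_simps)
    ultimately have "c * e (Suc j) = c * (2 * u * W (1 + int j) - c * W (int j)) - (u - R * Rb) * (c * W (1 + int j))"
      by simp
    also have "\<dots> = (u + R * Rb) * (c * W (1 + int j)) - (c * c) * W (int j)"
      by (simp add: algebra_simps)
    also have "c * c = (u + R * Rb) * (u - R * Rb)"
      using uc_eq RRb_sq by (simp add: algebra_simps)
    finally show "(u + R * Rb) * e j = c * e (Suc j)"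
      by (simp add: e_def algebra_simps)
  qed
  then show ?thesis by (simp add: e_def)
qed

lemma slit_series_0: "W 0 * R = 1"
proof -
  have "W 0 - tvar * (Apoly A 0 * W 0 + Apoly A 1 * (W (- 1) + W 1)) = u * W 0 - c * W 1"
    using slit_series_uminus[of 1] by (simp add: algebra_simps)
  also have "\<dots> = Rb * (W 0 * R)"
    using slit_series_Suc[of 0] by (simp add: algebra_simps)
  finally have "Rb * (W 0 * R) \<in> xle 0"
    using slit_series_boundary by simp
  then have "W 0 * R \<in> xle 0"
    using Rb_xle Rb_nonneg Rb_0 nonneg.mult_mem[OF slit_series_nonneg[of 0] R_nonneg] unfolding xle_0
    by - (rule nonpos.fls_quotient_mem_fls_over[of Rb], auto simp: nonneg_exps_def)
  moreover have "W 0 * R \<in> xge 0"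
    using xge_mult[OF slit_series_0_xge R_xge] by simp
  ultimately have "W 0 * R = tembed (xcoeff (W 0 * R) 0)"
    using laurent_expansion[of "W 0 * R" 0 0] by simp
  also have "xcoeff (W 0 * R) 0 = 1"
    using slit_series_0_xge R_xge
    by (subst xside_xcoeff_mult_0[of 1]) (auto simp: xge_0_xside xcoeff_slit_series_0 xcoeff_R_0)
  finally show ?thesis by simp
qed

lemma slit_series_closed_form: "c ^ j * W (int j) = fplus A j / R - fminus A j * Rb"
proof -
  have "c ^ j * W (int j) = (u - R * Rb) ^ j * W 0"
  proof (induction j)
    case (Suc j)
    have "c ^ Suc j * W (int (Suc j)) = c ^ j * (c * W (int (Suc j)))"
      by (simp only: power_Suc2 mult.assoc)
    also have "\<dots> = (u - R * Rb) * (c ^ j * W (int j))"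
      unfolding slit_series_Suc by (simp only: mult_ac)
    finally show ?case
      unfolding Suc by (simp only: power_Suc mult.assoc)
  qed simp
  also have "\<dots> = (fplus A j - R * Rb * fminus A j) * W 0"
    by (simp only: diff_power_eq_fplus_fminus[OF RRb_sq])
  also have "W 0 = 1 / R"
    by (rule eq_divide_imp[OF R_nz slit_series_0])
  finally show ?thesis
    by (simp add: diff_divide_distrib)
qed

section \<open>The Laurent polynomial g and its outer coefficients\<close>

definition "g j = fplus A j / R - c ^ j * Splus A (int j)"

lemma g_eq: "g j = fminus A j * Rb + c ^ j * Sminus A (int j)"
  using slit_series_closed_form[of j] by (simp add: g_def slit_series_def algebra_simps)

lemma K_subfield: "is_subfield K"
  unfolding QA_def by (rule is_subfield_gen_field)

sublocale K: subring_set K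
  by (rule subring_set_of_subfield[OF K_subfield])

sublocale KG: subring_set "xcoeffs_ge K"
  by (rule subring_set_xcoeffs_ge) unfold_locales

sublocale KL: subring_set "xcoeffs_le K"
  by (rule subring_set_xcoeffs_le) unfold_locales

lemma K_gens:
  "ratfuns \<subseteq> K" "fsqrt (xcoeff D 0) \<in> K" "xcoeff Dl (int k) \<in> K" "xcoeff Dlb (- int k) \<in> K"
  "\<alpha> \<in> alphas A \<Longrightarrow> fls_const \<alpha> \<in> K" "\<alpha> \<in> alphas A \<Longrightarrow> fsqrt (evalx Dl \<alpha>) \<in> K"
  unfolding QA_def by (auto intro!: subsetD[OF gen_field_incl])

lemma X_mem_K: "fls_X \<in> K"
  using K_gens(1) fls_X_mem_ratfuns by blast

lemma xcoeff_Dl_mem: "xcoeff Dl k \<in> K"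
  using K_gens(3)[of "nat k"] Dl_xge by (cases "k < 0") (auto simp: xge_iff)

lemma xcoeff_Dlb_mem: "xcoeff Dlb k \<in> K"
  using K_gens(4)[of "nat (- k)"] Dlb_xle by (cases "k > 0") (auto simp: xle_iff)

lemma xcoeff_D_mem: "xcoeff D 0 \<in> K"
proof -
  have "fsqrt (xcoeff D 0) * fsqrt (xcoeff D 0) = xcoeff D 0"
    using D_nonneg D_0 by (intro fsqrt_props) (auto simp: nonneg_exps_def)
  then show ?thesis using K_gens(2) K.mult_mem by metis
qed

lemma xcoeff_R_mem: "xcoeff R k \<in> K"
  by (rule xside_sqrt_coeff_mem[OF K_subfield, of 1])
    (use R_xge in \<open>auto simp: xge_0_xside R_sq xcoeff_Dl_mem xcoeff_R_0\<close>)

text \<open>The inverse is \<open>W 0\<close>, so its exponents are known from counting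
  walks.\<close>

lemma inverse_R_xge: "inverse R \<in> xge 0" and inverse_R_nonneg: "inverse R \<in> nonneg_exps"
proof -
  have "W 0 = inverse R"
    using eq_divide_imp[OF R_nz slit_series_0] by (simp add: divide_inverse)
  then show "inverse R \<in> xge 0" "inverse R \<in> nonneg_exps"
    using slit_series_0_xge slit_series_nonneg[of 0] by auto
qed

lemma xcoeff_inverse_R_mem: "xcoeff (inverse R) k \<in> K"
  by (rule xside_quotient_coeff_mem[OF K_subfield, of 1 R])
    (use R_xge inverse_R_xge in \<open>auto simp: xge_0_xside xcoeff_R_mem xcoeff_R_0 xcoeff_1\<close>)

lemma xcoeff_Rb_mem: "xcoeff Rb k \<in> K"
proof (rule xside_sqrt_coeff_mem[OF K_subfield, of "- 1"])
  show "xcoeff (Rb * Rb) k \<in> K" for k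
    using xcoeff_tembed_mult[of "xcoeff D 0" Dlb k] D_eq xcoeff_D_mem xcoeff_Dlb_mem by (auto simp: Rb_sq)
  have "fsqrt (xcoeff D 0) $$ 0 = 1"
    using D_nonneg D_0 by (intro fsqrt_props) (auto simp: nonneg_exps_def)
  then show "xcoeff Rb 0 \<noteq> 0" by (auto simp: xcoeff_Rb_0)
qed (use Rb_xle K_gens in \<open>auto simp: xle_0_xside xcoeff_Rb_0\<close>)

lemma step_polys_KG: "Apoly A h \<in> xcoeffs_ge K" "fplus A j \<in> xcoeffs_ge K"
  and step_polys_KL: "Apoly A h \<in> xcoeffs_le K" "fminus A j \<in> xcoeffs_le K"
  and tvar_KG: "tvar \<in> xcoeffs_ge K" and tvar_KL: "tvar \<in> xcoeffs_le K"
proof -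
  show G: "tvar \<in> xcoeffs_ge K" and L: "tvar \<in> xcoeffs_le K"
    unfolding tembed_X[symmetric] using X_mem_K
    by (auto intro: tembed_mem_xcoeffs_ge tembed_mem_xcoeffs_le)
  show "Apoly A h \<in> xcoeffs_ge K" "fplus A j \<in> xcoeffs_ge K"
    by (intro step_polys_mem KG.subring_set_axioms G xpow_mem_xcoeffs_ge; simp)+
  show "Apoly A h \<in> xcoeffs_le K" "fminus A j \<in> xcoeffs_le K"
    by (intro step_polys_mem KL.subring_set_axioms L xpow_mem_xcoeffs_le; simp)+
qed

lemma plus_part_mem: "fplus A j / R \<in> xcoeffs_ge K"
proof -
  have "inverse R \<in> xcoeffs_ge K"
    using inverse_R_xge xcoeff_inverse_R_mem by (auto simp: xcoeffs_ge_def)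
  then show ?thesis
    using step_polys_KG(2) by (auto simp: divide_inverse)
qed

lemma minus_part_mem: "fminus A j * Rb \<in> xcoeffs_le K"
proof -
  have "Rb \<in> xcoeffs_le K"
    using Rb_xle xcoeff_Rb_mem by (auto simp: xcoeffs_le_def)
  then show ?thesis
    using step_polys_KL(2) by auto
qed

definition "lo = Min {i. (i, 1) \<in> A}"
definition "hi = Max {i. (i, 1) \<in> A}"

lemma lo_mem: "(lo, 1) \<in> A" and hi_mem: "(hi, 1) \<in> A" and lo_le: "(i, 1) \<in> A \<Longrightarrow> lo \<le> i"
  and hi_ge: "(i, 1) \<in> A \<Longrightarrow> i \<le> hi"
  using Min_in[of "{i. (i, 1) \<in> A}"] Max_in[of "{i. (i, 1) \<in> A}"] A1_nonzero
  by (auto simp: lo_def hi_def)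

lemma xcoeff_Apoly: "xcoeff (Apoly A 1) k = (if (k, 1) \<in> A then 1 else 0)"
  by (simp add: Apoly_def xcoeff_sum xcoeff_xpow)

lemma xcoeff_c: "xcoeff c k = (if (k, 1) \<in> A then 2 * fls_X else 0)"
proof -
  have "c = tembed (2 * fls_X) * Apoly A 1"
    using tembed_add[of fls_X fls_X] by (simp add: tembed_X)
  then show ?thesis by (simp only: xcoeff_tembed_mult xcoeff_Apoly) simp
qed

lemma c_xge: "c \<in> xge lo" and c_xle: "c \<in> xle hi"
  using lo_le hi_ge by (fastforce simp: xge_iff xle_iff xcoeff_c)+

lemma cSplus_xge: "c ^ j * Splus A (int j) \<in> xge (int j * lo)"
proof -
  have "Splus A (int j) \<in> xge 0" by (simp add: xge_iff xcoeff_Splus)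
  from xge_mult[OF xge_power[OF c_xge, of j] this] show ?thesis by simp
qed

text \<open>The \<open>- 1\<close> matters: since \<open>Sminus\<close> starts at exponent -1, the
  exponents of \<open>g j\<close> left open form the half-open interval from
  \<open>int j * lo\<close> to \<open>int j * hi\<close>, whose size is the degree of $A_1^j$ and
  not one more.\<close>

lemma cSminus_xle: "c ^ j * Sminus A (int j) \<in> xle (int j * hi - 1)"
proof -
  have "Sminus A (int j) \<in> xle (- 1)" by (simp add: xle_iff xcoeff_Sminus finA)
  from xle_mult[OF xle_power[OF c_xle, of j] this] show ?thesis by simp
qed

lemma g_xge: "\<exists>M. g j \<in> xge M"
proof -
  obtain M where "fplus A j / R \<in> xge M" using plus_part_mem by (auto simp: xcoeffs_ge_def)
  then have "g j \<in> xge (min M (int j * lo))"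
    unfolding g_def by (intro xge_diff xge_mono[OF cSplus_xge]) (auto intro: xge_mono)
  then show ?thesis ..
qed

lemma g_xle: "\<exists>M. g j \<in> xle M"
proof -
  obtain M where "fminus A j * Rb \<in> xle M" using minus_part_mem by (auto simp: xcoeffs_le_def)
  then have "g j \<in> xle (max M (int j * hi - 1))"
    unfolding g_eq by (intro xle_add xle_mono[OF cSminus_xle]) (auto intro: xle_mono)
  then show ?thesis ..
qed

text \<open>Outside the interval one of the two walk series does not contribute, and the explicit
  part, whose coefficients are in \<open>K\<close>, is all that remains.\<close>

lemma xcoeff_g_mem_outside:
  assumes "k < int j * lo \<or> k \<ge> int j * hi"
  shows "xcoeff (g j) k \<in> K"
  using assms
proof
  assume "k < int j * lo"
  then have "xcoeff (g j) k = xcoeff (fplus A j / R) k"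
    using cSplus_xge[of j] by (simp add: g_def xcoeff_diff xge_iff)
  then show ?thesis using plus_part_mem by (simp add: xcoeffs_ge_def)
next
  assume "k \<ge> int j * hi"
  then have "xcoeff (g j) k = xcoeff (fminus A j * Rb) k"
    using cSminus_xle[of j] by (simp add: g_eq xcoeff_add xle_iff)
  then show ?thesis using minus_part_mem by (simp add: xcoeffs_le_def)
qed

end

subsection \<open>Evaluation at the roots of the step polynomial\<close>

text \<open>The sum inside \<open>evalx\<close> for a single power of t. On an infinite support it
  is 0 by convention, so the ring laws below are stated for Laurent polynomials.\<close>

definition leval :: "complex fls \<Rightarrow> complex \<Rightarrow> complex" where
  "leval p \<alpha> = (\<Sum>k | p $$ k \<noteq> 0. p $$ k * \<alpha> powi k)"

lemma leval_superset:
  assumes "finite I" "{k. p $$ k \<noteq> 0} \<subseteq> I"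
  shows "leval p \<alpha> = (\<Sum>k\<in>I. p $$ k * \<alpha> powi k)"
  unfolding leval_def using assms by (intro sum.mono_neutral_left) auto

lemma leval_0 [simp]: "leval 0 \<alpha> = 0"
  by (simp add: leval_def)

lemma leval_const [simp]: "leval (fls_const a) \<alpha> = a"
  by (subst leval_superset[of "{0}"]) auto

lemma leval_X_intpow: "leval (fls_X_intpow k) \<alpha> = \<alpha> powi k"
  by (subst leval_superset[of "{k}"]) auto

lemma leval_add:
  assumes "p \<in> laurent_polys" "q \<in> laurent_polys"
  shows "leval (p + q) \<alpha> = leval p \<alpha> + leval q \<alpha>"
proof -
  let ?I = "{k. p $$ k \<noteq> 0} \<union> {k. q $$ k \<noteq> 0}"
  have fin: "finite ?I" using assms by (simp add: laurent_polys_def)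
  have "leval (p + q) \<alpha> = (\<Sum>k\<in>?I. (p + q) $$ k * \<alpha> powi k)"
    by (rule leval_superset[OF fin]) auto
  also have "\<dots> = (\<Sum>k\<in>?I. p $$ k * \<alpha> powi k) + (\<Sum>k\<in>?I. q $$ k * \<alpha> powi k)"
    by (simp add: algebra_simps sum.distrib)
  also have "(\<Sum>k\<in>?I. p $$ k * \<alpha> powi k) = leval p \<alpha>"
    by (rule leval_superset[OF fin, symmetric]) auto
  also have "(\<Sum>k\<in>?I. q $$ k * \<alpha> powi k) = leval q \<alpha>"
    by (rule leval_superset[OF fin, symmetric]) auto
  finally show ?thesis .
qed

lemma leval_sum:
  assumes "\<And>i. i \<in> I \<Longrightarrow> f i \<in> laurent_polys"
  shows "leval (sum f I) \<alpha> = (\<Sum>i\<in>I. leval (f i) \<alpha>)"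
  using assms
  by (induction I rule: infinite_finite_induct) (auto simp: leval_add laurent.sum_mem)

lemma leval_mult:
  assumes "p \<in> laurent_polys" "q \<in> laurent_polys" and \<alpha>: "\<alpha> \<noteq> 0"
  shows "leval (p * q) \<alpha> = leval p \<alpha> * leval q \<alpha>"
proof -
  define I where "I = {k. p $$ k \<noteq> 0}"
  define J where "J = {k. q $$ k \<noteq> 0}"
  define S where "S = (\<lambda>(i, j). i + j) ` (I \<times> J)"
  have fin: "finite I" "finite J" "finite S"
    using assms by (auto simp: I_def J_def S_def laurent_polys_def)
  have nth: "(p * q) $$ k = (\<Sum>i\<in>I. p $$ i * q $$ (k - i))" for k
    by (rule fls_times_nth_superset[OF fin(1)]) (auto simp: I_def)
  have inner: "(\<Sum>k\<in>S. q $$ (k - i) * \<alpha> powi (k - i)) = leval q \<alpha>" if i: "i \<in> I" for i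
  proof -
    have "(\<Sum>k\<in>S. q $$ (k - i) * \<alpha> powi (k - i)) = (\<Sum>j\<in>(\<lambda>k. k - i) ` S. q $$ j * \<alpha> powi j)"
      by (subst sum.reindex) (auto simp: inj_on_def)
    also have "\<dots> = leval q \<alpha>"
    proof (rule leval_superset[symmetric])
      show "{k. q $$ k \<noteq> 0} \<subseteq> (\<lambda>k. k - i) ` S"
      proof
        fix k assume "k \<in> {k. q $$ k \<noteq> 0}"
        then have "i + k \<in> S" using i by (force simp: S_def J_def)
        then show "k \<in> (\<lambda>k. k - i) ` S" by (rule rev_image_eqI) simp
      qed
    qed (use fin in auto)
    finally show ?thesis .
  qed
  have "{k. (p * q) $$ k \<noteq> 0} \<subseteq> S"
  proof
    fix k assume "k \<in> {k. (p * q) $$ k \<noteq> 0}"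
    then have "(\<Sum>i\<in>I. p $$ i * q $$ (k - i)) \<noteq> 0" by (simp add: nth)
    then obtain i where "i \<in> I" "p $$ i * q $$ (k - i) \<noteq> 0"
      by (rule sum.not_neutral_contains_not_neutral)
    then have "(i, k - i) \<in> I \<times> J" "k = i + (k - i)" by (auto simp: J_def)
    then show "k \<in> S" unfolding S_def by force
  qed
  then have "leval (p * q) \<alpha> = (\<Sum>k\<in>S. (p * q) $$ k * \<alpha> powi k)"
    by (rule leval_superset[OF fin(3)])
  also have "\<dots> = (\<Sum>k\<in>S. \<Sum>i\<in>I. p $$ i * \<alpha> powi i * (q $$ (k - i) * \<alpha> powi (k - i)))"
    using \<alpha> by (auto simp: nth sum_distrib_right power_int_diff intro!: sum.cong)
  also have "\<dots> = (\<Sum>i\<in>I. p $$ i * \<alpha> powi i * (\<Sum>k\<in>S. q $$ (k - i) * \<alpha> powi (k - i)))"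
    by (subst sum.swap) (simp add: sum_distrib_left)
  also have "\<dots> = leval p \<alpha> * leval q \<alpha>"
    using inner by (simp add: sum_distrib_right leval_def I_def)
  finally show ?thesis .
qed

lemma X_intpow_mem_laurent [simp, intro]: "fls_X_intpow k \<in> laurent_polys"
  and const_mem_laurent [simp, intro]: "fls_const a \<in> laurent_polys"
  and X_mem_laurent [simp, intro]: "fls_X \<in> laurent_polys"
  by (auto simp: laurent_polys_def)

lemma X_intpow_minus_const_dvd:
  fixes \<alpha> :: complex
  assumes "\<alpha> \<noteq> 0"
  shows "\<exists>q\<in>laurent_polys. fls_X_intpow k - fls_const (\<alpha> powi k) = (fls_X - fls_const \<alpha>) * q"
proof -
  have pos: "\<exists>q\<in>laurent_polys. (fls_X::complex fls) ^ n - fls_const \<alpha> ^ n = (fls_X - fls_const \<alpha>) * q" for n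
  proof
    show "(fls_X::complex fls) ^ n - fls_const \<alpha> ^ n
        = (fls_X - fls_const \<alpha>) * (\<Sum>i<n. fls_const \<alpha> ^ (n - Suc i) * fls_X ^ i)"
      by (rule power_diff_sumr2)
    show "(\<Sum>i<n. fls_const \<alpha> ^ (n - Suc i) * fls_X ^ i) \<in> laurent_polys"
      by (intro laurent.sum_mem laurent.mult_mem laurent.power_mem X_mem_laurent const_mem_laurent)
  qed
  show ?thesis
  proof (cases "k \<ge> 0")
    case True
    then have "fls_X_intpow k - fls_const (\<alpha> powi k) = fls_X ^ nat k - fls_const \<alpha> ^ nat k"
      by (simp add: power_int_def fls_const_power fls_X_power_conv_shift_1)
    with pos[of "nat k"] show ?thesis by simp
  next
    case False
    define n where "n = nat (- k)"
    have k: "k = - int n" using False by (simp add: n_def)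
    obtain q where q: "q \<in> laurent_polys" "fls_X ^ n - fls_const \<alpha> ^ n = (fls_X - fls_const \<alpha>) * q"
      using pos[of n] by blast
    have 1: "fls_X_intpow k * fls_X ^ n = (1 :: complex fls)"
      using fls_X_intpow_times_fls_X_intpow[of k "int n", where 'a = complex]
      by (simp add: k fls_X_power_conv_shift_1)
    have 2: "fls_const (\<alpha> powi k) * fls_const \<alpha> ^ n = 1"
      using assms by (simp add: k power_int_minus flip: fls_const_power)
    have "fls_X_intpow k - fls_const (\<alpha> powi k)
        = - (fls_X_intpow k * fls_const (\<alpha> powi k)) * (fls_X ^ n - fls_const \<alpha> ^ n)"
    proof -
      have alg: "- (x * a) * (y - b) = x * (a * b) - (x * y) * a" for x a y b :: "complex fls"
        by (simp add: algebra_simps)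
      have "- (fls_X_intpow k * fls_const (\<alpha> powi k)) * (fls_X ^ n - fls_const \<alpha> ^ n)
        = fls_X_intpow k * (fls_const (\<alpha> powi k) * fls_const \<alpha> ^ n) - (fls_X_intpow k * fls_X ^ n) * fls_const (\<alpha> powi k)"
        by (rule alg)
      then show ?thesis by (simp only: 1 2) simp
    qed
    also have "\<dots> = (fls_X - fls_const \<alpha>) * (- (fls_X_intpow k * fls_const (\<alpha> powi k)) * q)"
      by (simp only: q(2) mult_ac)
    finally show ?thesis
      using q(1) by (intro bexI[of _ "- (fls_X_intpow k * fls_const (\<alpha> powi k)) * q"])
        (auto intro!: laurent.mult_mem laurent.uminus_mem)
  qed
qed

text \<open>The factor theorem, obtained from the monomials by linearity.\<close>

lemma laurent_minus_leval_dvd: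
  assumes p: "p \<in> laurent_polys" and "\<alpha> \<noteq> 0"
  shows "\<exists>q\<in>laurent_polys. p - fls_const (leval p \<alpha>) = (fls_X - fls_const \<alpha>) * q"
proof -
  define I where "I = {k. p $$ k \<noteq> 0}"
  have fin: "finite I" using p by (simp add: I_def laurent_polys_def)
  obtain q where q: "\<And>k. q k \<in> laurent_polys"
    "\<And>k. fls_X_intpow k - fls_const (\<alpha> powi k) = (fls_X - fls_const \<alpha>) * q k"
    using X_intpow_minus_const_dvd[OF assms(2)] by metis
  have p_eq: "p = (\<Sum>k\<in>I. fls_const (p $$ k) * fls_X_intpow k)"
    using fin by (intro fls_eqI) (auto simp: fls_nth_sum I_def if_distrib cong: if_cong)
  have "fls_const (leval p \<alpha>) = (\<Sum>k\<in>I. fls_const (p $$ k) * fls_const (\<alpha> powi k))"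
    by (intro fls_eqI) (auto simp: fls_nth_sum I_def leval_def)
  then have "p - fls_const (leval p \<alpha>) = (\<Sum>k\<in>I. fls_const (p $$ k) * (fls_X_intpow k - fls_const (\<alpha> powi k)))"
    by (subst p_eq) (simp only: sum_subtractf right_diff_distrib)
  also have "\<dots> = (fls_X - fls_const \<alpha>) * (\<Sum>k\<in>I. fls_const (p $$ k) * q k)"
    by (simp only: q(2) sum_distrib_left mult_ac)
  finally show ?thesis
    using q(1) by (intro bexI[of _ "\<Sum>k\<in>I. fls_const (p $$ k) * q k"]) (auto intro!: laurent.sum_mem laurent.mult_mem)
qed

text \<open>The domain on which evaluation at a nonzero x is a ring homomorphism. The exponents of x
  may be unbounded as the power of t grows, which \<open>Splus\<close> and \<open>inverse R\<close>
  require.\<close>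

abbreviation E :: "complex fls fls set" where
  "E \<equiv> fls_over laurent_polys"

interpretation E: subring_set E
  by (rule laurent.subring_set_fls_over)

lemma E_nth: "F \<in> E \<Longrightarrow> F $$ n \<in> laurent_polys"
  by (simp add: fls_over_def)

lemma tembed_mem_E [simp, intro]: "tembed e \<in> E" and xpow_mem_E [simp, intro]: "xpow k \<in> E"
  by (auto simp: fls_over_def xpow_def)

lemma evalx_nth: "evalx F \<alpha> $$ n = leval (F $$ n) \<alpha>"
proof -
  have "\<forall>n<fls_subdegree F. leval (F $$ n) \<alpha> = 0" by simp
  then show ?thesis
    unfolding evalx_def leval_def[symmetric] by (intro nth_Abs_fls_ex_lower_bound) blast
qed

lemma evalx_add: "F \<in> E \<Longrightarrow> G \<in> E \<Longrightarrow> evalx (F + G) \<alpha> = evalx F \<alpha> + evalx G \<alpha>"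
  by (rule fls_eqI) (simp add: evalx_nth leval_add E_nth)

lemma evalx_mult:
  assumes "F \<in> E" "G \<in> E" "\<alpha> \<noteq> 0"
  shows "evalx (F * G) \<alpha> = evalx F \<alpha> * evalx G \<alpha>"
proof (rule fls_eqI)
  fix n
  let ?I = "{fls_subdegree F..n - fls_subdegree G}"
  have "evalx (F * G) \<alpha> $$ n = (\<Sum>a\<in>?I. leval (F $$ a) \<alpha> * leval (G $$ (n - a)) \<alpha>)"
    using assms E_nth by (simp add: evalx_nth fls_times_nth(2) leval_sum leval_mult laurent.mult_mem)
  also have "\<dots> = (evalx F \<alpha> * evalx G \<alpha>) $$ n"
  proof -
    have "a \<in> ?I" if "evalx F \<alpha> $$ a * evalx G \<alpha> $$ (n - a) \<noteq> 0" for a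
    proof (rule ccontr)
      assume "a \<notin> ?I"
      then have "F $$ a = 0 \<or> G $$ (n - a) = 0" by auto
      with that show False by (auto simp: evalx_nth)
    qed
    then show ?thesis
      by (subst fls_times_nth_superset[of ?I]) (auto simp: evalx_nth)
  qed
  finally show "evalx (F * G) \<alpha> $$ n = (evalx F \<alpha> * evalx G \<alpha>) $$ n" .
qed

lemma evalx_tembed [simp]: "evalx (tembed e) \<alpha> = e"
  by (rule fls_eqI) (simp add: evalx_nth)

lemma evalx_1 [simp]: "evalx 1 \<alpha> = 1"
  using evalx_tembed[of 1] by simp

lemma evalx_2 [simp]: "evalx 2 \<alpha> = 2"
  using evalx_add[of 1 1 \<alpha>] by (simp add: one_add_one)

lemma evalx_xpow: "evalx (xpow k) \<alpha> = fls_const (\<alpha> powi k)"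
  by (rule fls_eqI) (simp add: evalx_nth xpow_def leval_X_intpow)

lemma E_divide_root:
  assumes F: "F \<in> E" and \<alpha>: "\<alpha> \<noteq> 0"
  obtains G where "G \<in> E" "F = tembed (evalx F \<alpha>) + (xpow 1 - tembed (fls_const \<alpha>)) * G"
proof
  define d :: "complex fls" where "d = fls_X - fls_const \<alpha>"
  \<comment> \<open>The inverse of \<open>d\<close> is an infinite Laurent series in x. The product
    is nevertheless in \<open>E\<close>, because \<open>d\<close> divides each coefficient of the
    second factor in the ring of Laurent polynomials.\<close>
  define G where "G = fls_const (inverse d) * (F - tembed (evalx F \<alpha>))"
  have "d $$ 1 \<noteq> 0" by (simp add: d_def)
  then have d: "d \<noteq> 0" by (metis fls_zero_nth)
  have "tembed (fls_const \<alpha>) = fls_const (fls_const \<alpha>)"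
    by (rule fls_eqI) simp
  then have xd: "xpow 1 - tembed (fls_const \<alpha>) = fls_const d"
    by (simp add: d_def xpow_def fls_minus_const fls_X_conv_shift_1)
  show "G \<in> E"
    unfolding fls_over_def
  proof safe
    fix n
    obtain q where q: "q \<in> laurent_polys" "F $$ n - fls_const (leval (F $$ n) \<alpha>) = d * q"
      using laurent_minus_leval_dvd[OF E_nth[OF F] \<alpha>] d_def by metis
    have "G $$ n = q"
      using q(2) d by (simp add: G_def evalx_nth)
    with q show "G $$ n \<in> laurent_polys" by simp
  qed
  show "F = tembed (evalx F \<alpha>) + (xpow 1 - tembed (fls_const \<alpha>)) * G"
    unfolding xd G_def mult.assoc[symmetric] using d by simp
qed

subsection \<open>Polynomials in x over the Laurent series in t\<close>

text \<open>Embeds univariate polynomials over the field of series in t, whose divisibility theory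
  then becomes available for double series.\<close>

definition xpoly :: "complex fls poly \<Rightarrow> complex fls fls" where
  "xpoly p = poly (map_poly tembed p) (xpow 1)"

lemma xpoly_0 [simp]: "xpoly 0 = 0"
  by (simp add: xpoly_def)

lemma xpoly_pCons: "xpoly (pCons a p) = tembed a + xpow 1 * xpoly p"
  by (simp add: xpoly_def map_poly_pCons)

lemma xpoly_1 [simp]: "xpoly 1 = 1"
  by (simp add: one_pCons xpoly_pCons)

lemma xpoly_add: "xpoly (p + q) = xpoly p + xpoly q"
  by (induction p q rule: poly_induct2) (simp_all add: xpoly_pCons tembed_add algebra_simps)

lemma xpoly_uminus: "xpoly (- p) = - xpoly p"
  using xpoly_add[of p "- p"] by (simp add: eq_neg_iff_add_eq_0 add.commute)

lemma xpoly_diff: "xpoly (p - q) = xpoly p - xpoly q"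
  using xpoly_add[of p "- q"] by (simp add: xpoly_uminus)

lemma xpoly_smult: "xpoly (smult a p) = tembed a * xpoly p"
  by (induction p) (simp_all add: xpoly_pCons tembed_mult algebra_simps)

lemma xpoly_mult: "xpoly (p * q) = xpoly p * xpoly q"
  by (induction p) (simp_all add: xpoly_pCons xpoly_add xpoly_smult algebra_simps)

lemma xpoly_mem_E [simp, intro]: "xpoly p \<in> E"
  by (induction p) (auto simp: xpoly_pCons)

lemma evalx_xpoly: "\<alpha> \<noteq> 0 \<Longrightarrow> evalx (xpoly p) \<alpha> = poly p (fls_const \<alpha>)"
  by (induction p) (simp_all add: xpoly_pCons evalx_add evalx_mult evalx_xpow E.mult_mem, simp add: fls_eq_iff evalx_nth)

lemma xcoeff_xpoly: "xcoeff (xpoly p) k = (if k \<ge> 0 then poly.coeff p (nat k) else 0)"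
proof (induction p arbitrary: k)
  case (pCons a p)
  show ?case
    using pCons.IH[of "k - 1"]
    by (cases "nat k") (auto simp: xpoly_pCons xcoeff_add xcoeff_tembed xcoeff_xpow_mult coeff_pCons nat_diff_distrib split: nat.splits)
qed simp

lemma xpoly_eq_iff [simp]: "xpoly p = xpoly q \<longleftrightarrow> p = q"
proof
  assume "xpoly p = xpoly q"
  then have "poly.coeff p n = poly.coeff q n" for n
    using xcoeff_xpoly[of p "int n"] xcoeff_xpoly[of q "int n"] by simp
  then show "p = q" by (rule poly_eqI)
qed simp

lemma xpoly_exists:
  assumes "F \<in> xge 0" "F \<in> xle b"
  obtains p where "F = xpoly p" "\<And>i. poly.coeff p i = xcoeff F (int i)"
proof -
  define p where "p = Poly (map (\<lambda>k. xcoeff F (int k)) [0..<nat (b + 1)])"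
  have c: "poly.coeff p i = xcoeff F (int i)" for i
    using assms(2) by (auto simp: p_def nth_default_def xle_iff)
  have "F = xpoly p"
    using assms(1) by (intro xcoeff_eqI) (auto simp: xcoeff_xpoly c xge_iff)
  with c that show ?thesis by blast
qed

section \<open>Congruences modulo a product of linear factors\<close>

definition root_poly :: "complex list \<Rightarrow> complex fls poly" where
  "root_poly as = (\<Prod>a\<leftarrow>as. [:- fls_const a, 1:])"

lemma root_poly_Nil [simp]: "root_poly [] = 1"
  and root_poly_Cons: "root_poly (a # as) = [:- fls_const a, 1:] * root_poly as"
  and root_poly_append: "root_poly (as @ bs) = root_poly as * root_poly bs"
  by (simp_all add: root_poly_def)

lemma xpoly_linear: "xpoly [:- a, 1:] = xpow 1 - tembed a"
  by (simp add: xpoly_pCons tembed_uminus)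

lemma root_poly_nz [simp]: "root_poly as \<noteq> 0"
  by (induction as) (simp_all add: root_poly_Cons del: mult_pCons_left)

text \<open>Divisibility in \<open>E\<close> implies divisibility of polynomials: evaluation at each
  listed root splits off a linear factor. Zero is excluded because evaluation there is not
  multiplicative on Laurent polynomials.\<close>

lemma xpoly_root_poly_dvd:
  assumes "xpoly p = xpoly (root_poly as) * F" "F \<in> E" "0 \<notin> set as"
  obtains q where "p = root_poly as * q" "F = xpoly q"
  using assms
proof (induction as arbitrary: p thesis)
  case Nil
  then show ?case by simp
next
  case (Cons a as)
  have a: "a \<noteq> 0" using Cons.prems by auto
  have "poly p (fls_const a) = evalx (xpoly p) a"
    using a by (simp add: evalx_xpoly)
  also have "\<dots> = 0"
    using a Cons.prems(2,3) by (simp add: evalx_mult evalx_xpoly root_poly_Cons del: mult_pCons_left)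
  finally have "[:- fls_const a, 1:] dvd p" by (simp add: poly_eq_0_iff_dvd)
  then obtain p' where p': "p = [:- fls_const a, 1:] * p'" by (elim dvdE)
  have "xpoly [:- fls_const a, 1:] \<noteq> 0"
    using xpoly_eq_iff[of "[:- fls_const a, 1:]" 0] by simp
  then have "xpoly p' = xpoly (root_poly as) * F"
    using Cons.prems(2) unfolding p' root_poly_Cons xpoly_mult mult.assoc by simp
  then obtain q where "p' = root_poly as * q" "F = xpoly q"
    using Cons.IH[of p'] Cons.prems by auto
  then show ?case
    by (intro Cons.prems(1)[of q]) (simp_all add: p' root_poly_Cons mult.assoc del: mult_pCons_left)
qed

context
  fixes K :: "complex fls set"
  assumes K: "is_subfield K"
begin

interpretation subring_set K by (rule subring_set_of_subfield[OF K])
interpretation PK: subring_set "poly_over K" by (rule subring_set_poly_over)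

lemma root_poly_mem: "fls_const ` set as \<subseteq> K \<Longrightarrow> root_poly as \<in> poly_over K"
  by (induction as) (simp_all add: root_poly_Cons linear_mult_mem_poly_over_iff del: mult_pCons_left)

lemma root_poly_mult_mem_iff:
  "fls_const ` set as \<subseteq> K \<Longrightarrow> root_poly as * q \<in> poly_over K \<longleftrightarrow> q \<in> poly_over K"
  by (induction as) (simp_all add: root_poly_Cons linear_mult_mem_poly_over_iff mult.assoc del: mult_pCons_left)

text \<open>The degree bound makes \<open>p\<close> the remainder of \<open>r\<close> modulo the
  root polynomial, and division by monic linear factors over \<open>K\<close> stays over
  \<open>K\<close>.\<close>

lemma remainder_mem_poly_over:
  assumes "root_poly as dvd p - r" "r \<in> poly_over K" "\<And>i. i \<ge> length as \<Longrightarrow> poly.coeff p i = 0"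
    "fls_const ` set as \<subseteq> K"
  shows "p \<in> poly_over K"
  using assms
proof (induction as arbitrary: p r)
  case Nil
  then show ?case by (auto simp: poly_over_def)
next
  case (Cons a as)
  let ?a = "fls_const a"
  have aK: "?a \<in> K" using Cons.prems by auto
  define p' where "p' = synthetic_div p ?a"
  define r' where "r' = synthetic_div r ?a"
  have p_eq: "p = [:- ?a, 1:] * p' + [:poly p ?a:]" and r_eq: "r = [:- ?a, 1:] * r' + [:poly r ?a:]"
    unfolding p'_def r'_def by (simp_all only: synthetic_div_correct')
  have "[:- ?a, 1:] dvd p - r"
    using Cons.prems(1) unfolding root_poly_Cons by (rule dvd_mult_left)
  \<comment> \<open>The common value at the root is the last remainder, and it lies in
    \<open>K\<close> because it is computed from \<open>r\<close>.\<close>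
  then have pr: "poly p ?a = poly r ?a"
    by (simp add: poly_eq_0_iff_dvd[symmetric])
  have diff: "p - r = [:- ?a, 1:] * (p' - r')"
    by (subst p_eq, subst r_eq) (simp only: pr right_diff_distrib, simp)
  have "root_poly as dvd p' - r'"
    using Cons.prems(1) unfolding diff root_poly_Cons by (subst (asm) dvd_times_left_cancel_iff) auto
  moreover have "r' \<in> poly_over K"
    unfolding r'_def by (intro synthetic_div_mem_poly_over Cons.prems aK)
  moreover have "poly.coeff p' i = 0" if "i \<ge> length as" for i
  proof (cases "p' = 0")
    case False
    have "Polynomial.degree p \<le> length as"
      using Cons.prems(3) by (intro degree_le) auto
    moreover have "Polynomial.degree p' = Polynomial.degree p - 1"
      by (simp add: p'_def degree_synthetic_div)
    moreover have "Polynomial.degree p \<noteq> 0"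
      using False synthetic_div_eq_0_iff[of p ?a] by (simp add: p'_def)
    ultimately have "Polynomial.degree p' < i" using that by linarith
    then show ?thesis by (rule coeff_eq_0)
  qed simp
  ultimately have p'K: "p' \<in> poly_over K"
    using Cons.prems(4) by - (rule Cons.IH, auto)
  have "poly r ?a \<in> K"
    using Cons.prems(2) aK by (intro poly_mem) (simp_all add: poly_over_def)
  then have "[:poly p ?a:] \<in> poly_over K"
    by (simp add: pr)
  then show ?case
    by (subst p_eq) (intro PK.add_mem iffD2[OF linear_mult_mem_poly_over_iff[OF aK]] p'K)
qed

text \<open>Newton interpolation of an inverse square root: each new root contributes one coefficient, which
  is read off from the value at the root if the root is new, and from the quadratic equation modulo
  the next power if the root is repeated.\<close>
lemma inverse_sqrt_interpolation:
  assumes I: "I \<in> E" "I * I * xpoly d = 1" and d: "d \<in> poly_over K"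
    and as: "0 \<notin> set as" "fls_const ` set as \<subseteq> K" "\<And>a. a \<in> set as \<Longrightarrow> evalx I a \<in> K"
  shows "\<exists>r\<in>poly_over K. \<exists>G\<in>E. I = xpoly r + xpoly (root_poly as) * G"
  using as
proof (induction as)
  case Nil
  show ?case
    using I(1) by (intro bexI[of _ 0] bexI[of _ I]) auto
next
  case (Cons a as)
  let ?a = "fls_const a" and ?M = "root_poly as"
  have a: "a \<noteq> 0" "?a \<in> K" "evalx I a \<in> K" using Cons.prems by auto
  have MK: "?M \<in> poly_over K" using Cons.prems by (intro root_poly_mem) auto
  obtain r G where r: "r \<in> poly_over K" and G: "G \<in> E" and I_eq: "I = xpoly r + xpoly ?M * G"
    using Cons by auto
  define c where "c = evalx G a"
  obtain H where H: "H \<in> E" "G = tembed c + (xpow 1 - tembed ?a) * H"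
    using E_divide_root[OF G a(1)] unfolding c_def by metis
  have pK: "poly q ?a \<in> K" if "q \<in> poly_over K" for q
    using that a(2) by (intro poly_mem) (simp_all add: poly_over_def)
  have evI: "evalx I a = poly r ?a + poly ?M ?a * c"
    using a G by (simp add: I_eq evalx_add evalx_mult evalx_xpoly c_def E.mult_mem)
  have cK: "c \<in> K"
  proof (cases "poly ?M ?a = 0")
    case False
    then have "c = (evalx I a - poly r ?a) * inverse (poly ?M ?a)"
      using evI by (simp add: field_simps)
    then show ?thesis
      using a pK[OF r] pK[OF MK] by (simp add: mult_mem diff_mem is_subfieldD(6)[OF K])
  next
    case True
    \<comment> \<open>Substituting \<open>I = r + M * G\<close> into $I^2 d = 1$ shows that
      \<open>M\<close> divides the error of the approximation \<open>r\<close>.\<close>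
    have "xpoly (1 - r * r * d) = xpoly ?M * ((2 * xpoly r * G + xpoly ?M * G * G) * xpoly d)"
      using I(2) by (simp add: I_eq xpoly_diff xpoly_mult algebra_simps)
    moreover have "(2 * xpoly r * G + xpoly ?M * G * G) * xpoly d \<in> E"
      using G by (intro E.mult_mem E.add_mem) auto
    ultimately obtain q where q: "1 - r * r * d = ?M * q"
        "(2 * xpoly r * G + xpoly ?M * G * G) * xpoly d = xpoly q"
      using xpoly_root_poly_dvd[of "1 - r * r * d" as] Cons.prems by auto
    have "?M * q \<in> poly_over K"
      unfolding q(1)[symmetric] using r d by auto
    then have qK: "q \<in> poly_over K"
      using Cons.prems by (simp add: root_poly_mult_mem_iff)
    \<comment> \<open>At the repeated root the quadratic term in \<open>G\<close> vanishes, which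
      leaves a linear equation for \<open>c\<close>.\<close>
    have "poly q ?a = evalx ((xpoly r * G + xpoly r * G + xpoly ?M * G * G) * xpoly d) a"
      using q(2) a evalx_xpoly[of a q] by (simp add: mult_2 algebra_simps)
    also have "\<dots> = 2 * poly r ?a * poly d ?a * c"
      using a G True by (simp add: evalx_mult evalx_add evalx_xpoly c_def E.mult_mem E.add_mem algebra_simps)
    finally have eq: "poly q ?a = 2 * poly r ?a * poly d ?a * c" .
    \<comment> \<open>At the root \<open>I\<close> and \<open>r\<close> agree, so $r^2 d = 1$ there
      and the coefficient of \<open>c\<close> is nonzero.\<close>
    have "poly r ?a * poly r ?a * poly d ?a = evalx (I * I * xpoly d) a"
      using a I(1) evI True by (simp add: evalx_mult evalx_xpoly E.mult_mem)
    then have "poly r ?a * poly r ?a * poly d ?a = 1" by (simp add: I(2))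
    then have "2 * poly r ?a * poly d ?a \<noteq> 0" by auto
    then have "c = poly q ?a * inverse (2 * poly r ?a * poly d ?a)"
      using eq by (simp add: field_simps)
    then show ?thesis
      using pK[OF r] pK[OF d] pK[OF qK] by (simp only: mult_mem numeral_mem is_subfieldD(6)[OF K])
  qed
  have "I = xpoly (r + smult c ?M) + xpoly (root_poly (a # as)) * H"
    unfolding I_eq H(2) root_poly_Cons xpoly_mult xpoly_add xpoly_smult xpoly_linear
    by (simp only: algebra_simps)
  moreover have "r + smult c ?M \<in> poly_over K"
    using r cK MK by auto
  ultimately show ?case
    using H(1) by blast
qed

text \<open>Series whose residue modulo the root polynomial has a representative over
  \<open>K\<close>. As a ring it carries interpolation from \<open>inverse R\<close> over to
  \<open>fplus A j / R\<close>.\<close>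

definition poly_mod :: "complex list \<Rightarrow> complex fls fls set" where
  "poly_mod as = {F. \<exists>r\<in>poly_over K. \<exists>G\<in>E. F = xpoly r + xpoly (root_poly as) * G}"

lemma poly_modI: "r \<in> poly_over K \<Longrightarrow> G \<in> E \<Longrightarrow> xpoly r + xpoly (root_poly as) * G \<in> poly_mod as"
  by (auto simp: poly_mod_def)

lemma xpoly_mem_poly_mod: "r \<in> poly_over K \<Longrightarrow> xpoly r \<in> poly_mod as"
  using poly_modI[of r 0] by simp

lemma subring_set_poly_mod: "subring_set (poly_mod as)"
proof
  show "0 \<in> poly_mod as" "1 \<in> poly_mod as"
    using xpoly_mem_poly_mod[of 0] xpoly_mem_poly_mod[of 1] by auto
  let ?M = "xpoly (root_poly as)"
  fix F F' assume "F \<in> poly_mod as" "F' \<in> poly_mod as"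
  then obtain r G r' G' where *: "r \<in> poly_over K" "G \<in> E" "F = xpoly r + ?M * G"
      "r' \<in> poly_over K" "G' \<in> E" "F' = xpoly r' + ?M * G'"
    unfolding poly_mod_def by blast
  have "F + F' = xpoly (r + r') + ?M * (G + G')"
    using * by (simp add: xpoly_add algebra_simps)
  then show "F + F' \<in> poly_mod as"
    using * by (auto intro!: poly_modI)
  have "F * F' = xpoly (r * r') + ?M * (xpoly r * G' + xpoly r' * G + ?M * G * G')"
    using * by (simp add: xpoly_mult algebra_simps)
  then show "F * F' \<in> poly_mod as"
    using * by (auto intro!: poly_modI)
  have "- F = xpoly (- r) + ?M * (- G)"
    using * by (simp add: xpoly_uminus algebra_simps)
  then show "- F \<in> poly_mod as"
    using * by (auto intro!: poly_modI simp del: mult_minus_right)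
qed

text \<open>All roots are nonzero, so x is invertible modulo the root polynomial.\<close>

lemma xpow_mem_poly_mod:
  assumes as: "0 \<notin> set as" "fls_const ` set as \<subseteq> K"
  shows "xpow k \<in> poly_mod as"
proof -
  interpret S: subring_set "poly_mod as" by (rule subring_set_poly_mod)
  have p: "xpow 1 \<in> poly_mod as"
    using xpoly_mem_poly_mod[of "[:0, 1:]" as] by (simp add: xpoly_pCons)
  have n: "xpow (- 1) \<in> poly_mod as"
  proof -
    obtain m M' where M: "root_poly as = pCons m M'" by (rule pCons_cases)
    have mM: "m \<in> K" "M' \<in> poly_over K"
      using root_poly_mem[OF as(2)] by (simp_all add: M)
    have "m = poly (root_poly as) 0" by (simp add: M)
    also have "\<dots> \<noteq> 0"
      using as(1) by (induction as) (auto simp: root_poly_Cons)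
    finally have m: "m \<noteq> 0" .
    have "tembed (inverse m) * tembed m = 1"
      using m by (simp flip: tembed_mult)
    then have "xpow (- 1) = tembed (inverse m) * tembed m * xpow (- 1)" by simp
    also have "\<dots> = xpoly (smult (- inverse m) M') + xpoly (root_poly as) * (tembed (inverse m) * xpow (- 1))"
    proof -
      have "xpow 1 * (xpow (- 1) * F) = F" for F
        using xpow_mult[of 1 "- 1"] by (simp flip: mult.assoc)
      then show ?thesis
        by (simp add: M xpoly_pCons xpoly_smult xpoly_uminus algebra_simps)
    qed
    finally have eq: "xpow (- 1) = xpoly (smult (- inverse m) M') +
      xpoly (root_poly as) * (tembed (inverse m) * xpow (- 1))" .
    show ?thesis
      by (subst eq, rule poly_modI) (use mM is_subfieldD(6)[OF K] in \<open>auto simp del: smult_minus_left\<close>)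
  qed
  show ?thesis
  proof (cases "k \<ge> 0")
    case True
    then have "xpow k = xpow 1 ^ nat k" by (simp add: xpow_power)
    then show ?thesis using p by auto
  next
    case False
    then have "xpow k = xpow (- 1) ^ nat (- k)" by (simp add: xpow_power)
    then show ?thesis using n by auto
  qed
qed

lemma tembed_mem_poly_mod: "e \<in> K \<Longrightarrow> tembed e \<in> poly_mod as"
  using xpoly_mem_poly_mod[of "[:e:]"] by (simp add: xpoly_pCons)

lemma xpoly_mem_poly_mod_imp:
  assumes "xpoly p \<in> poly_mod as" "\<And>i. i \<ge> length as \<Longrightarrow> poly.coeff p i = 0"
    "0 \<notin> set as" "fls_const ` set as \<subseteq> K"
  shows "p \<in> poly_over K"
proof -
  obtain r G where r: "r \<in> poly_over K" "G \<in> E" "xpoly p = xpoly r + xpoly (root_poly as) * G"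
    using assms(1) by (auto simp: poly_mod_def)
  then have "xpoly (p - r) = xpoly (root_poly as) * G"
    by (simp add: xpoly_diff)
  then have "root_poly as dvd p - r"
    using xpoly_root_poly_dvd[of "p - r" as G] r(2) assms(3) by (metis dvd_triv_left)
  then show ?thesis
    using remainder_mem_poly_over r(1) assms(2,4) by blast
qed

end

subsection \<open>Coefficients in the field of the canonical factorization\<close>

lemma fls_const_sum: "fls_const (sum f I) = (\<Sum>i\<in>I. fls_const (f i))"
  by (induction I rule: infinite_finite_induct) (auto simp flip: fls_plus_const)

lemma map_poly_fls_const_mult:
  "map_poly fls_const (p * q) = map_poly fls_const p * map_poly fls_const q"
  by (rule poly_eqI) (simp add: coeff_map_poly coeff_mult fls_const_sum)

lemma map_poly_fls_const_prod_list:
  "map_poly fls_const (\<Prod>a\<leftarrow>as. [:- a, 1:]) = root_poly as"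
  by (induction as) (simp_all add: map_poly_fls_const_mult root_poly_Cons map_poly_pCons del: mult_pCons_left)

lemma evalx_sum:
  "(\<And>i. i \<in> I \<Longrightarrow> f i \<in> E) \<Longrightarrow> evalx (sum f I) \<alpha> = (\<Sum>i\<in>I. evalx (f i) \<alpha>)"
proof (induction I rule: infinite_finite_induct)
  case (insert i I)
  then show ?case by (simp add: evalx_add E.sum_mem)
qed (use evalx_tembed[of 0] in simp_all)

lemma xcoeff_tembed_sum:
  "finite I \<Longrightarrow> xcoeff (\<Sum>k\<in>I. tembed (e k) * xpow k) m = (if m \<in> I then e m else 0)"
  by (simp add: xcoeff_sum xcoeff_tembed_mult xcoeff_xpow if_distrib cong: if_cong)

lemma xside_xcoeff_power_0:
  assumes "s * s = 1" "\<And>n. F ^ n \<in> xside s"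
  shows "xcoeff (F ^ n) 0 = xcoeff F 0 ^ n"
proof (induction n)
  case (Suc n)
  then show ?case
    using xside_xcoeff_mult_0[OF assms(1) assms(2)[of 1] assms(2)[of n]] by simp
qed (simp add: xcoeff_1)

lemma root_poly_power: "root_poly (concat (replicate j as)) = root_poly as ^ j"
  by (induction j) (simp_all add: root_poly_append)

lemma poly_root_poly: "a \<in> set as \<Longrightarrow> poly (root_poly as) (fls_const a) = 0"
  by (induction as) (auto simp: root_poly_Cons)

lemma xpoly_power: "xpoly (p ^ n) = xpoly p ^ n"
  by (induction n) (simp_all add: xpoly_mult)

context slit_canonical
begin

lemma slit_series_mem_E: "W j \<in> E" and Splus_mem_E: "Splus A j \<in> E"
proof -
  have fin: "finite {i. F $$ n $$ i \<noteq> 0}"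
    if "\<And>i. F $$ n $$ i \<noteq> 0 \<Longrightarrow> acount A i j (nat n) \<noteq> 0" for F :: "complex fls fls" and n
    using that by (intro finite_subset[OF _ finite_acount_support[OF finA, of j "nat n"]]) auto
  show "W j \<in> E"
    unfolding fls_over_def laurent_polys_def
    by safe (rule fin, auto simp: slit_series_nth finA split: if_splits)
  show "Splus A j \<in> E"
    unfolding fls_over_def laurent_polys_def
    by safe (rule fin, auto simp: Splus_nth split: if_splits)
qed

text \<open>Through \<open>W 0 = 1 / R\<close>: finitely many walks of each length make every
  coefficient of t a Laurent polynomial.\<close>

lemma inverse_R_mem_E: "inverse R \<in> E"
  using eq_divide_imp[OF R_nz slit_series_0] slit_series_mem_E[of 0] by (simp add: divide_inverse)

lemma R_mem_E: "R \<in> E"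
proof (rule laurent.fls_sqrt_mem_fls_over)
  show "fls_const (1 / 2) * 2 = (1 :: complex fls)" by (rule fls_const_half)
qed (use Dl_laurent R_nonneg R_0 in \<open>auto simp: R_sq nonneg_exps_def\<close>)

lemma evalx_R: "a \<noteq> 0 \<Longrightarrow> evalx R a = fsqrt (evalx Dl a)"
proof (rule fsqrt_eqI[symmetric])
  show "a \<noteq> 0 \<Longrightarrow> evalx R a * evalx R a = evalx Dl a"
    using R_mem_E by (simp add: evalx_mult[symmetric] R_sq)
  have "leval 1 a = 1" using leval_const[of 1 a] by simp
  then show "\<forall>n<0. evalx R a $$ n = 0" "evalx R a $$ 0 = 1"
    using R_nonneg R_0 by (auto simp: evalx_nth nonneg_exps_def)
qed

lemma evalx_inverse_R_mem:
  assumes "a \<in> alphas A"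
  shows "evalx (inverse R) a \<in> K"
proof -
  have a: "a \<noteq> 0" using assms by (simp add: alphas_def)
  have "evalx (R * inverse R) a = evalx R a * evalx (inverse R) a"
    using a R_mem_E inverse_R_mem_E by (rule evalx_mult[rotated 2])
  then have "evalx R a * evalx (inverse R) a = 1" by simp
  then have "evalx (inverse R) a = inverse (evalx R a)" by (metis inverse_unique)
  then show ?thesis
    using K_gens(6)[OF assms] is_subfieldD(6)[OF K_subfield] by (simp add: evalx_R[OF a])
qed

text \<open>The field is a parameter: \<open>K\<close> serves for the degree bounds,
  \<open>ratfuns\<close> for algebraicity.\<close>

lemma delta_xcoeffs:
  assumes "is_subfield F" "fls_X \<in> F"
  shows "deltaA A \<in> xcoeffs_ge F" "deltaA A \<in> xcoeffs_le F"
proof -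
  have F: "subring_set F" by (rule subring_set_of_subfield[OF assms(1)])
  have t: "tvar \<in> xcoeffs_ge F" "tvar \<in> xcoeffs_le F"
    unfolding tembed_X[symmetric] using assms is_subfieldD[OF assms(1)]
    by (auto intro: tembed_mem_xcoeffs_ge tembed_mem_xcoeffs_le)
  show "deltaA A \<in> xcoeffs_ge F"
    by (intro step_polys_mem subring_set_xcoeffs_ge F t xpow_mem_xcoeffs_ge is_subfieldD[OF assms(1)])
  show "deltaA A \<in> xcoeffs_le F"
    by (intro step_polys_mem subring_set_xcoeffs_le F t xpow_mem_xcoeffs_le is_subfieldD[OF assms(1)])
qed

lemma xpow_nonneg: "xpow k \<in> nonneg_exps"
  by (simp add: nonneg_exps_def xpow_def)

lemma Dl_xle: "\<exists>b. Dl \<in> xle b"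
proof -
  obtain b where b: "deltaA A \<in> xle b"
    using delta_xcoeffs(2)[OF K_subfield X_mem_K] by (auto simp: xcoeffs_le_def)
  have "(D * Dlb) * (xpow (- b) * Dl) = xpow (- b) * deltaA A"
    by (simp add: delta_eq mult_ac)
  also have "\<dots> \<in> xle 0"
    using xle_mult[OF xpow_xle[of "- b"] b] by simp
  finally have "xpow (- b) * Dl \<in> xle 0"
    using DDlb_xle DDlb_nonneg DDlb_0 nonneg.mult_mem[OF xpow_nonneg[of "- b"] Dl_nonneg] unfolding xle_0
    by - (rule nonpos.fls_quotient_mem_fls_over[of "D * Dlb"], auto simp: nonneg_exps_def)
  from xle_mult[OF xpow_xle[of b] this] have "Dl \<in> xle b"
    by (simp add: xpow_mult mult.assoc[symmetric])
  then show ?thesis ..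
qed

lemma Dlb_xge: "\<exists>b. Dlb \<in> xge b"
proof -
  obtain b where b: "deltaA A \<in> xge b"
    using delta_xcoeffs(1)[OF K_subfield X_mem_K] by (auto simp: xcoeffs_ge_def)
  have DDl: "D * Dl \<in> xge 0" "D * Dl \<in> nonneg_exps" "(D * Dl) $$ 0 = 1"
    using xge_mult[OF tembed_xge[of "xcoeff D 0"] Dl_xge] D_nonneg Dl_nonneg D_0 Dl_0
    by (auto simp: nonneg_times_nth_0 D_eq[symmetric])
  have "(D * Dl) * (xpow (- b) * Dlb) = xpow (- b) * deltaA A"
    by (simp add: delta_eq mult_ac)
  also have "\<dots> \<in> xge 0"
    using xge_mult[OF xpow_xge[of "- b"] b] by simp
  finally have "xpow (- b) * Dlb \<in> xge 0"
    using DDl nonneg.mult_mem[OF xpow_nonneg[of "- b"] Dlb_nonneg] unfolding xge_0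
    by - (rule nonneg.fls_quotient_mem_fls_over[of "D * Dl"], auto simp: nonneg_exps_def)
  from xge_mult[OF xpow_xge[of b] this] have "Dlb \<in> xge b"
    by (simp add: xpow_mult mult.assoc[symmetric])
  then show ?thesis ..
qed

lemma Dl_eq_xpoly: obtains p where "Dl = xpoly p" "\<And>i. poly.coeff p i = xcoeff Dl (int i)"
  using Dl_xge Dl_xle xpoly_exists by metis

lemma evalx_Apoly: "evalx (Apoly A 1) a = fls_const (\<Sum>i\<in>{i. (i, 1) \<in> A}. a powi i)"
  unfolding Apoly_def by (subst evalx_sum) (auto simp: evalx_xpow fls_const_sum)

text \<open>After the shift by \<open>lo\<close> the lowest and the highest coefficient are both 1:
  the polynomial is monic, 0 is not a root, and the roots with multiplicity number
  \<open>hi - lo\<close>.\<close>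

lemma A1_roots:
  obtains as where "xpow (- lo) * Apoly A 1 = xpoly (root_poly as)" "set as \<subseteq> alphas A"
    "int (length as) = hi - lo"
proof -
  define P :: "complex poly" where
    "P = Poly (map (\<lambda>n. if (int n + lo, 1) \<in> A then 1 else 0) [0..<nat (hi - lo + 1)])"
  have le: "lo \<le> hi" using hi_ge lo_mem by blast
  have P: "poly.coeff P n = (if (int n + lo, 1) \<in> A then 1 else 0)" for n
    using hi_ge[of "int n + lo"] by (auto simp: P_def nth_default_def)
  have lead: "poly.coeff P (nat (hi - lo)) = 1" using le hi_mem by (simp add: P)
  have deg: "Polynomial.degree P = nat (hi - lo)"
  proof (rule antisym)
    show "Polynomial.degree P \<le> nat (hi - lo)"
      using hi_ge by (intro degree_le) (force simp: P)
    show "nat (hi - lo) \<le> Polynomial.degree P"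
      using lead by (intro le_degree) simp
  qed
  have "P \<noteq> 0" using lead by auto
  then obtain B where B: "size B = Polynomial.degree P"
      "P = smult (Polynomial.lead_coeff P) (\<Prod>x\<in>#B. [:- x, 1:])"
    using alg_closed_imp_factorization[of P] by metis
  obtain as where as: "mset as = B" using ex_mset by blast
  have "P = (\<Prod>a\<leftarrow>as. [:- a, 1:])"
    using B(2) lead by (simp add: deg as[symmetric] prod_mset_prod_list[symmetric] del: prod_mset_prod_list) 
  then have MP: "root_poly as = map_poly fls_const P"
    using map_poly_fls_const_prod_list by simp
  have eq: "xpow (- lo) * Apoly A 1 = xpoly (root_poly as)"
    using lo_le by (intro xcoeff_eqI)
      (force simp: xcoeff_xpow_mult xcoeff_Apoly xcoeff_xpoly MP coeff_map_poly P)
  have nz: "a \<noteq> 0" if "a \<in> set as" for a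
  proof
    assume "a = 0"
    then have "poly (root_poly as) 0 = 0" using poly_root_poly[OF that] by simp
    moreover have "poly (root_poly as) 0 = 1"
      using lo_mem by (simp add: poly_0_coeff_0 MP coeff_map_poly P)
    ultimately show False by simp
  qed
  have "set as \<subseteq> alphas A"
  proof
    fix a assume a: "a \<in> set as"
    have "evalx (xpow (- lo) * Apoly A 1) a = 0"
      using a nz[OF a] by (simp add: eq evalx_xpoly poly_root_poly)
    moreover have "evalx (xpow (- lo) * Apoly A 1) a = fls_const (a powi (- lo)) * evalx (Apoly A 1) a"
      using nz[OF a] by (subst evalx_mult) (auto simp: evalx_xpow Apoly_def)
    ultimately show "a \<in> alphas A"
      using nz[OF a] by (auto simp: alphas_def evalx_Apoly)
  qed
  moreover have "int (length as) = hi - lo"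
    using B(1) le by (simp add: as[symmetric] deg)
  ultimately show ?thesis
    using eq that by blast
qed

lemma xcoeff_g_mem: "xcoeff (g j) k \<in> K"
proof (cases "k \<in> {int j * lo..<int j * hi}")
  case False
  then show ?thesis using xcoeff_g_mem_outside[of k j] by auto
next
  case True
  obtain as where as: "xpow (- lo) * Apoly A 1 = xpoly (root_poly as)" "set as \<subseteq> alphas A"
      "int (length as) = hi - lo"
    by (rule A1_roots)
  \<comment> \<open>The roots of $A_1^j$ with multiplicity.\<close>
  define bs where "bs = concat (replicate j as)"
  have bs: "set bs \<subseteq> alphas A"
    using as(2) by (auto simp: bs_def)
  have "int (length bs) = int j * int (length as)"
    by (simp add: bs_def length_concat sum_list_replicate)
  then have len: "int (length bs) = int j * hi - int j * lo"
    by (simp add: as(3) right_diff_distrib)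
  have bs': "0 \<notin> set bs" "fls_const ` set bs \<subseteq> K"
    using bs K_gens(5) by (auto simp: alphas_def)
  interpret S: subring_set "poly_mod K bs" by (rule subring_set_poly_mod[OF K_subfield])
  have x: "xpow k \<in> poly_mod K bs" for k
    by (rule xpow_mem_poly_mod[OF K_subfield bs'])
  have t: "tvar \<in> poly_mod K bs"
    unfolding tembed_X[symmetric] by (rule tembed_mem_poly_mod[OF K_subfield X_mem_K])
  obtain d where d: "Dl = xpoly d" "\<And>i. poly.coeff d i = xcoeff Dl (int i)"
    by (rule Dl_eq_xpoly) blast
  have "inverse R \<in> poly_mod K bs"
    unfolding poly_mod_def[OF K_subfield] mem_Collect_eq
  proof (rule inverse_sqrt_interpolation[OF K_subfield])
    have "inverse R * inverse R * (R * R) = 1"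
      by (simp add: field_simps)
    then show "inverse R * inverse R * xpoly d = 1"
      by (simp only: R_sq d(1)[symmetric])
    show "d \<in> poly_over K" by (simp add: poly_over_def d(2) xcoeff_Dl_mem)
    show "evalx (inverse R) a \<in> K" if "a \<in> set bs" for a
      using that bs evalx_inverse_R_mem by auto
  qed (use bs' inverse_R_mem_E in auto)
  then have "fplus A j / R \<in> poly_mod K bs"
    using step_polys_mem(3)[OF S.subring_set_axioms t x] by (auto simp: divide_inverse)
  moreover have "c ^ j * Splus A (int j) \<in> poly_mod K bs"
  proof -
    \<comment> \<open>The walk series is multiplied by $A_1^j$, hence has residue 0 although its
      coefficients are not yet known to lie in \<open>K\<close>.\<close>
    have "Apoly A 1 = xpow lo * xpoly (root_poly as)"
      using xpow_mult[of lo "- lo"] by (simp add: as(1)[symmetric] mult.assoc[symmetric])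
    then have "c ^ j * Splus A (int j) = xpoly 0 + xpoly (root_poly bs) * ((2 * tvar * xpow lo) ^ j * Splus A (int j))"
      by (simp add: bs_def root_poly_power power_mult_distrib xpoly_power mult_ac)
    moreover have "(2 * tvar * xpow lo) ^ j * Splus A (int j) \<in> E"
      using Splus_mem_E by (intro E.mult_mem E.power_mem) auto
    ultimately show ?thesis
      by (simp only: poly_modI[OF K_subfield] K.zero_mem_poly_over)
  qed
  ultimately have g: "g j \<in> poly_mod K bs"
    unfolding g_def by auto
  obtain M N where MN: "g j \<in> xge M" "g j \<in> xle N" using g_xge g_xle by blast
  let ?I = "{int j * lo..<int j * hi}"
  \<comment> \<open>Only \<open>inn\<close> is unknown. As \<open>g j\<close> and \<open>out\<close>
    have residues over \<open>K\<close>, so does \<open>inn\<close>, and after a shift it is a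
    polynomial of degree below the number of roots, hence equal to its remainder.\<close>
  define inn where "inn = (\<Sum>k\<in>?I. tembed (xcoeff (g j) k) * xpow k)"
  define out where "out = (\<Sum>k\<in>{M..N} - ?I. tembed (xcoeff (g j) k) * xpow k)"
  have xi: "xcoeff inn k = (if k \<in> ?I then xcoeff (g j) k else 0)" for k
    unfolding inn_def by (rule xcoeff_tembed_sum) simp
  have xo: "xcoeff out k = (if k \<in> {M..N} - ?I then xcoeff (g j) k else 0)" for k
    unfolding out_def by (rule xcoeff_tembed_sum) simp
  have "inn = g j - out"
  proof (rule xcoeff_eqI)
    fix k
    have "xcoeff (g j) k = 0" if "k \<notin> {M..N}" using that MN by (auto simp: xge_iff xle_iff)
    then show "xcoeff inn k = xcoeff (g j - out) k"
      unfolding xcoeff_diff xi xo by (cases "k \<in> {M..N}"; cases "k \<in> ?I") auto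
  qed
  moreover have "out \<in> poly_mod K bs"
    unfolding out_def using x xcoeff_g_mem_outside
    by (intro S.sum_mem S.mult_mem tembed_mem_poly_mod[OF K_subfield]) auto
  ultimately have inn: "xpow (- (int j * lo)) * inn \<in> poly_mod K bs"
    using g x by auto
  have "xpow (- (int j * lo)) * inn \<in> xge 0" "xpow (- (int j * lo)) * inn \<in> xle (int (length bs))"
    by (auto simp: xge_iff xle_iff xcoeff_xpow_mult xi len)
  then obtain p where p: "xpow (- (int j * lo)) * inn = xpoly p"
      "\<And>i. poly.coeff p i = xcoeff (xpow (- (int j * lo)) * inn) (int i)"
    by (rule xpoly_exists) blast
  have "p \<in> poly_over K"
  proof (rule xpoly_mem_poly_mod_imp[OF K_subfield])
    show "xpoly p \<in> poly_mod K bs" using inn p by simp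
    show "poly.coeff p i = 0" if "i \<ge> length bs" for i
      using that len by (auto simp: p(2) xcoeff_xpow_mult xi)
  qed (use bs' in auto)
  then have "poly.coeff p (nat (k - int j * lo)) \<in> K" by (simp add: poly_over_def)
  then show ?thesis
    using True by (simp add: p(2) xcoeff_xpow_mult xi)
qed

text \<open>The factor $c^j$ must be removed. Shifting by the extreme exponent of $A_1$ puts its
  extreme term at exponent 0, with coefficient 2t; this is invertible in \<open>K\<close>, so
  one-sided division applies. Negative heights follow by reflection.\<close>

lemma Sij_mem: "Sij A i j \<in> K"
proof -
  have nat_case: "Sij A i (int j) \<in> K" for j
  proof (cases "i \<ge> 0")
    case True
    have Fp: "(xpow (- lo) * c) ^ n \<in> xge 0" for n
      using xge_power[OF xge_mult[OF xpow_xge[of "- lo"] c_xge], of n] by simp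
    have "xcoeff (Splus A (int j)) i \<in> K"
    proof (rule xside_quotient_coeff_mem[OF K_subfield])
      show "(1::int) * 1 = 1" by simp
      show "(xpow (- lo) * c) ^ j \<in> xside 1" using Fp by (simp add: xge_0_xside)
      show "Splus A (int j) \<in> xside 1" by (simp add: xside_def xcoeff_Splus)
      have "xpow (- lo) \<in> xcoeffs_ge K" by (rule xpow_mem_xcoeffs_ge) auto
      then have "(xpow (- lo) * c) ^ j \<in> xcoeffs_ge K"
        using tvar_KG step_polys_KG by (intro KG.power_mem KG.mult_mem) auto
      then show "xcoeff ((xpow (- lo) * c) ^ j) k \<in> K" for k by (simp add: xcoeffs_ge_def)
      have "(xpow (- lo) * c) ^ j * Splus A (int j) = xpow (- (int j * lo)) * (fplus A j / R - g j)"
        by (simp add: g_def power_mult_distrib xpow_power mult.assoc)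
      then show "xcoeff ((xpow (- lo) * c) ^ j * Splus A (int j)) k \<in> K" for k
        using plus_part_mem[of j] xcoeff_g_mem
        by (simp only: xcoeff_xpow_mult xcoeff_diff) (auto simp: xcoeffs_ge_def)
      have "xcoeff (xpow (- lo) * c) 0 \<noteq> 0"
        using lo_mem by (simp only: xcoeff_xpow_mult xcoeff_c) simp
      then show "xcoeff ((xpow (- lo) * c) ^ j) 0 \<noteq> 0"
        using xside_xcoeff_power_0[of 1 "xpow (- lo) * c" j] Fp unfolding xge_0_xside
        by (metis mult_1 power_not_zero)
    qed
    then show ?thesis using True by (simp add: xcoeff_Splus)
  next
    case False
    have Fp: "(xpow (- hi) * c) ^ n \<in> xle 0" for n
      using xle_power[OF xle_mult[OF xpow_xle[of "- hi"] c_xle], of n] by simp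
    have "xcoeff (Sminus A (int j)) i \<in> K"
    proof (rule xside_quotient_coeff_mem[OF K_subfield])
      show "(- 1::int) * - 1 = 1" by simp
      show "(xpow (- hi) * c) ^ j \<in> xside (- 1)" using Fp by (simp add: xle_0_xside)
      show "Sminus A (int j) \<in> xside (- 1)" by (simp add: xside_def xcoeff_Sminus finA)
      have "xpow (- hi) \<in> xcoeffs_le K" by (rule xpow_mem_xcoeffs_le) auto
      then have "(xpow (- hi) * c) ^ j \<in> xcoeffs_le K"
        using tvar_KL step_polys_KL by (intro KL.power_mem KL.mult_mem) auto
      then show "xcoeff ((xpow (- hi) * c) ^ j) k \<in> K" for k by (simp add: xcoeffs_le_def)
      have "(xpow (- hi) * c) ^ j * Sminus A (int j) = xpow (- (int j * hi)) * (g j - fminus A j * Rb)"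
        by (simp add: g_eq power_mult_distrib xpow_power mult.assoc)
      then show "xcoeff ((xpow (- hi) * c) ^ j * Sminus A (int j)) k \<in> K" for k
        using minus_part_mem[of j] xcoeff_g_mem
        by (simp only: xcoeff_xpow_mult xcoeff_diff) (auto simp: xcoeffs_le_def)
      have "xcoeff (xpow (- hi) * c) 0 \<noteq> 0"
        using hi_mem by (simp only: xcoeff_xpow_mult xcoeff_c) simp
      then show "xcoeff ((xpow (- hi) * c) ^ j) 0 \<noteq> 0"
        using xside_xcoeff_power_0[of "- 1" "xpow (- hi) * c" j] Fp unfolding xle_0_xside by simp
    qed
    then show ?thesis using False by (simp add: xcoeff_Sminus finA)
  qed
  show ?thesis
    using nat_case[of "nat j"] nat_case[of "nat (- j)"] Sij_uminus[of i j] by (cases "j \<ge> 0") auto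
qed

end

subsection \<open>Algebraicity over the rational functions\<close>

definition rat_series :: "rat poly \<Rightarrow> complex fls" where
  "rat_series p = fps_to_fls (fps_of_poly (map_poly of_rat p))"

lemma rat_series_0: "rat_series 0 = 0" and rat_series_1: "rat_series 1 = 1"
  by (simp_all add: rat_series_def)

lemma rat_series_add: "rat_series (p + q) = rat_series p + rat_series q"
proof -
  have "map_poly of_rat (p + q) = map_poly of_rat p + (map_poly of_rat q :: complex poly)"
    by (rule poly_eqI) (simp add: coeff_map_poly of_rat_add)
  then show ?thesis by (simp add: rat_series_def fps_of_poly_add)
qed

lemma rat_series_mult: "rat_series (p * q) = rat_series p * rat_series q"
proof -
  have "map_poly of_rat (p * q) = map_poly of_rat p * (map_poly of_rat q :: complex poly)"
    by (rule poly_eqI) (simp add: coeff_map_poly coeff_mult of_rat_sum of_rat_mult)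
  then show ?thesis by (simp add: rat_series_def fps_of_poly_mult fls_times_fps_to_fls)
qed

lemma rat_series_uminus: "rat_series (- p) = - rat_series p"
  using rat_series_add[of p "- p"] by (simp add: rat_series_0 eq_neg_iff_add_eq_0 add.commute)

lemma rat_series_eq_0_iff: "rat_series p = 0 \<longleftrightarrow> p = 0"
  by (simp add: rat_series_def map_poly_eq_0_iff)

lemma ratfuns_eq: "ratfuns = {rat_series p / rat_series q | p q. q \<noteq> 0}"
  by (simp add: ratfuns_def rat_series_def)

lemma ratfunsI: "q \<noteq> 0 \<Longrightarrow> s = rat_series p / rat_series q \<Longrightarrow> s \<in> ratfuns"
  unfolding ratfuns_eq by blast

lemma is_subfield_ratfuns: "is_subfield ratfuns"
  unfolding is_subfield_def
proof (intro conjI ballI impI)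
  show "0 \<in> ratfuns" by (rule ratfunsI[of 1 _ 0]) (simp_all add: rat_series_0)
  show "1 \<in> ratfuns" by (rule ratfunsI[of 1 _ 1]) (simp_all add: rat_series_1)
  fix a assume "a \<in> ratfuns"
  then obtain p q where a: "a = rat_series p / rat_series q" "q \<noteq> 0"
    by (auto simp: ratfuns_eq)
  show "- a \<in> ratfuns"
    using a by (intro ratfunsI[of q _ "- p"]) (simp_all add: rat_series_uminus)
  show "inverse a \<in> ratfuns" if "a \<noteq> 0"
    using a that by (intro ratfunsI[of p _ q]) (auto simp: rat_series_0)
  fix b assume "b \<in> ratfuns"
  then obtain r s where b: "b = rat_series r / rat_series s" "s \<noteq> 0"
    by (auto simp: ratfuns_eq)
  show "a + b \<in> ratfuns"
    using a b by (intro ratfunsI[of "q * s" _ "p * s + r * q"])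
      (simp_all add: rat_series_add rat_series_mult rat_series_eq_0_iff add_frac_eq)
  show "a * b \<in> ratfuns"
    using a b by (intro ratfunsI[of "q * s" _ "p * r"]) (simp_all add: rat_series_mult)
qed

lemma subset_algebraic_elements:
  assumes "is_subfield K"
  shows "K \<subseteq> algebraic_elements K"
proof
  fix a assume "a \<in> K"
  interpret subring_set K by (rule subring_set_of_subfield[OF assms])
  show "a \<in> algebraic_elements K"
    unfolding algebraic_elements_def mem_Collect_eq
  proof (intro exI conjI allI)
    show "poly [:- a, 1:] a = 0" by simp
    have "[:- a, 1:] \<in> poly_over K" using \<open>a \<in> K\<close> by auto
    then show "poly.coeff [:- a, 1:] i \<in> K" for i by (rule poly_over_coeff)
  qed simp
qed

lemma algebraic_over_Qt_iff: "algebraic_over_Qt s \<longleftrightarrow> s \<in> algebraic_elements ratfuns"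
  by (simp add: algebraic_over_Qt_def algebraic_elements_def)

context slit_canonical
begin

abbreviation "Alg \<equiv> algebraic_elements ratfuns"

lemma Alg_subfield: "is_subfield Alg"
  by (rule is_subfield_algebraic_elements[OF is_subfield_ratfuns])

sublocale Alg: subring_set Alg
  by (rule subring_set_of_subfield[OF Alg_subfield])

lemma canonical_coeffs_algebraic:
  "xcoeff Dl k \<in> Alg" "xcoeff Dlb k \<in> Alg" "xcoeff D 0 \<in> Alg"
proof -
  obtain p where p: "Dl = xpoly p" "\<And>i. poly.coeff p i = xcoeff Dl (int i)"
    by (rule Dl_eq_xpoly) blast
  obtain b where b: "Dlb \<in> xge b" using Dlb_xge by blast
  have b': "xpow (- b) * Dlb \<in> xge 0" "xpow (- b) * Dlb \<in> xle (- b)"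
    using xge_mult[OF xpow_xge[of "- b"] b] xle_mult[OF xpow_xle[of "- b"] Dlb_xle] by simp_all
  obtain p' where p': "xpow (- b) * Dlb = xpoly p'" "\<And>i. poly.coeff p' i = xcoeff (xpow (- b) * Dlb) (int i)"
    using b' by (rule xpoly_exists) blast
  have b0: "b \<le> 0"
    using b xcoeff_Dlb_0 by (cases "b \<le> 0") (auto simp: xge_iff)
  define q where "q = smult (xcoeff D 0) (p' * p)"
  have "xpoly q = tembed (xcoeff D 0) * (xpow (- b) * Dlb * Dl)"
    by (simp add: q_def xpoly_smult xpoly_mult p(1) p'(1))
  also have "\<dots> = xpow (- b) * deltaA A"
    unfolding D_eq[symmetric] delta_eq by (simp add: mult_ac)
  finally have q: "xpoly q = xpow (- b) * deltaA A" .
  have "deltaA A \<in> xcoeffs_ge ratfuns"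
    by (rule delta_xcoeffs(1)[OF is_subfield_ratfuns fls_X_mem_ratfuns])
  moreover have "poly.coeff q i = xcoeff (deltaA A) (int i + b)" for i
    using xcoeff_xpoly[of q "int i"] by (simp add: q xcoeff_xpow_mult)
  ultimately have qR: "q \<in> poly_over ratfuns"
    by (simp add: poly_over_def xcoeffs_ge_def)
  have "deltaA A $$ 0 = 1"
    using D_nonneg Dl_nonneg Dlb_nonneg by (simp add: delta_eq nonneg_times_nth_0 D_0 Dl_0 Dlb_0 nonneg.mult_mem)
  then have "deltaA A \<noteq> 0" by auto
  then have q0: "q \<noteq> 0" using q by (auto simp del: xpoly_eq_iff)
  have "poly.coeff p 0 = 1" by (simp add: p(2) xcoeff_Dl_0)
  moreover have "p dvd q" "p' dvd q" by (auto simp: q_def intro: dvd_smult)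
  ultimately have pA: "poly.coeff p i \<in> Alg" for i
    by (intro factor_coeff_algebraic[OF is_subfield_ratfuns _ q0 qR])
  \<comment> \<open>The shift by \<open>- b\<close> moves the constant term of \<open>Dlb\<close>,
    which is 1, to this index.\<close>
  have "poly.coeff p' (nat (- b)) = 1"
    using b0 by (simp add: p'(2) xcoeff_xpow_mult xcoeff_Dlb_0)
  with \<open>p' dvd q\<close> have p'A: "poly.coeff p' i \<in> Alg" for i
    by (intro factor_coeff_algebraic[OF is_subfield_ratfuns _ q0 qR])
  show "xcoeff Dl k \<in> Alg"
    using pA[of "nat k"] by (simp add: p(1) xcoeff_xpoly)
  have "xcoeff (xpoly p') (k - b) \<in> Alg"
    using p'A by (simp add: xcoeff_xpoly)
  then show "xcoeff Dlb k \<in> Alg"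
    by (simp add: p'(1)[symmetric] xcoeff_xpow_mult)
  obtain n where n: "poly.coeff q n \<noteq> 0" using q0 by (metis leading_coeff_0_iff)
  have "poly.coeff (p' * p) n \<in> Alg"
    using pA p'A by (auto simp: coeff_mult)
  moreover have "poly.coeff q n \<in> Alg"
    using qR subset_algebraic_elements[OF is_subfield_ratfuns] by (auto simp: poly_over_def)
  moreover have "xcoeff D 0 = poly.coeff q n * inverse (poly.coeff (p' * p) n)"
    using n by (simp add: q_def)
  ultimately show "xcoeff D 0 \<in> Alg"
    by (simp only: Alg.mult_mem is_subfieldD(6)[OF Alg_subfield])
qed

text \<open>The root polynomial is the shifted $A_1$, whose coefficients are 0 and 1 and thus lie in
  \<open>ratfuns\<close>.\<close>

lemma alphas_algebraic:
  assumes "a \<in> alphas A"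
  shows "fls_const a \<in> Alg"
proof -
  have a: "a \<noteq> 0" using assms by (simp add: alphas_def)
  obtain as where as: "xpow (- lo) * Apoly A 1 = xpoly (root_poly as)"
    using A1_roots by blast
  interpret Q: subring_set ratfuns by (rule subring_set_of_subfield[OF is_subfield_ratfuns])
  have "poly.coeff (root_poly as) i = (if (int i + lo, 1) \<in> A then 1 else 0)" for i
    using xcoeff_xpoly[of "root_poly as" "int i"] by (simp add: as[symmetric] xcoeff_xpow_mult xcoeff_Apoly)
  then have "poly.coeff (root_poly as) i \<in> ratfuns" for i
    by simp
  moreover have "poly (root_poly as) (fls_const a) = evalx (xpow (- lo) * Apoly A 1) a"
    using a by (simp add: as evalx_xpoly)
  moreover have "\<dots> = 0"
    using a assms by (subst evalx_mult) (auto simp: evalx_Apoly alphas_def, auto simp: Apoly_def)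
  ultimately show ?thesis
    unfolding algebraic_elements_def by (auto intro!: exI[of _ "root_poly as"])
qed

lemma QA_algebraic: "K \<subseteq> Alg"
  unfolding QA_def
proof (rule gen_field_least[OF Alg_subfield], safe)
  fix s assume "s \<in> ratfuns"
  then show "s \<in> Alg" using subset_algebraic_elements[OF is_subfield_ratfuns] by blast
next
  have "fsqrt (xcoeff D 0) * fsqrt (xcoeff D 0) = xcoeff D 0"
    using D_nonneg D_0 by (intro fsqrt_props) (auto simp: nonneg_exps_def)
  then show "fsqrt (xcoeff D 0) \<in> Alg"
    using canonical_coeffs_algebraic(3) by - (rule sqrt_mem_algebraic_elements[OF is_subfield_ratfuns], simp)
next
  fix a assume a: "a \<in> alphas A"
  then show "fls_const a \<in> Alg" by (rule alphas_algebraic)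
  obtain p where p: "Dl = xpoly p" "\<And>i. poly.coeff p i = xcoeff Dl (int i)"
    by (rule Dl_eq_xpoly) blast
  have a0: "a \<noteq> 0" using a by (simp add: alphas_def)
  have "evalx Dl a = poly p (fls_const a)" using a0 by (simp add: p(1) evalx_xpoly)
  also have "\<dots> \<in> Alg"
    using alphas_algebraic[OF a] canonical_coeffs_algebraic(1) by (intro Alg.poly_mem) (simp_all add: p(2))
  finally have "evalx R a * evalx R a \<in> Alg"
    using a0 R_mem_E by (simp add: evalx_mult[symmetric] R_sq)
  then show "fsqrt (evalx Dl a) \<in> Alg"
    unfolding evalx_R[OF a0, symmetric] by (rule sqrt_mem_algebraic_elements[OF is_subfield_ratfuns])
qed (simp_all add: canonical_coeffs_algebraic)

end

theorem mainTheorem10: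
  fixes A :: "(int \<times> int) set" and D Dl Dlb :: "complex fls fls"
  assumes finA: "finite A"
    and symA: "\<And>i j. (i, j) \<in> A \<Longrightarrow> (i, - j) \<in> A"
    and heights: "\<And>i j. (i, j) \<in> A \<Longrightarrow> \<bar>j\<bar> \<le> 1"
    and A1_nonzero: "\<exists>i. (i, 1) \<in> A"
    and canon: "canonical_factorization A D Dl Dlb"
  shows "(\<forall>j::nat. \<exists>K e. finite K \<and> (\<forall>k\<in>K. e k \<in> QA A D Dl Dlb) \<and>
            (let g = (\<Sum>k\<in>K. tembed (e k) * xpow k) in
              (2 * tvar * Apoly A 1) ^ j * Splus A (int j) = fplus A j / fsqrt Dl - g \<and>
              (2 * tvar * Apoly A 1) ^ j * Sminus A (int j) = g - fminus A j * fsqrt (D * Dlb)))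
       \<and> (\<forall>i j. Sij A i j \<in> QA A D Dl Dlb \<and> algebraic_over_Qt (Sij A i j))"
proof -
  interpret slit_canonical A D Dl Dlb
    using assms by unfold_locales
  show ?thesis
  proof (intro conjI allI)
    fix j :: nat
    obtain M N where MN: "g j \<in> xge M" "g j \<in> xle N" using g_xge g_xle by blast
    have g: "(\<Sum>k\<in>{M..N}. tembed (xcoeff (g j) k) * xpow k) = g j"
      by (rule laurent_expansion[OF MN, symmetric])
    show "\<exists>K e. finite K \<and> (\<forall>k\<in>K. e k \<in> QA A D Dl Dlb) \<and>
            (let g = (\<Sum>k\<in>K. tembed (e k) * xpow k) in
              (2 * tvar * Apoly A 1) ^ j * Splus A (int j) = fplus A j / fsqrt Dl - g \<and>
              (2 * tvar * Apoly A 1) ^ j * Sminus A (int j) = g - fminus A j * fsqrt (D * Dlb))"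
    proof (intro exI[of _ "{M..N}"] exI[of _ "xcoeff (g j)"] conjI ballI)
      show "xcoeff (g j) k \<in> QA A D Dl Dlb" for k by (rule xcoeff_g_mem)
      show "let g = (\<Sum>k\<in>{M..N}. tembed (xcoeff (g j) k) * xpow k) in
              (2 * tvar * Apoly A 1) ^ j * Splus A (int j) = fplus A j / fsqrt Dl - g \<and>
              (2 * tvar * Apoly A 1) ^ j * Sminus A (int j) = g - fminus A j * fsqrt (D * Dlb)"
        unfolding g Let_def
      proof
        show "c ^ j * Splus A (int j) = fplus A j / R - g j" by (simp add: g_def)
        show "c ^ j * Sminus A (int j) = g j - fminus A j * Rb" by (simp add: g_eq)
      qed
    qed simp
  next
    fix i j
    show "Sij A i j \<in> QA A D Dl Dlb" by (rule Sij_mem)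
    then show "algebraic_over_Qt (Sij A i j)"
      using QA_algebraic by (auto simp: algebraic_over_Qt_iff)
  qed
qed

end
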